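(* Let $p$ be an odd prime and let $\mathfrak{S}_O=\bigcup_T\mathcal{B}_T\subset\mathbb{C}(\mathbb{F}_p)$ be the oscillator system, the union being over all maximal tori (split and non-split) $T\subset Sp=SL_2(\mathbb{F}_p)$. Then for every $g\in Sp$, every maximal torus $T\subset Sp$ and every $\varphi\in\mathcal{B}_T$, the vector $\rho(g)\varphi$ is, up to multiplication by a unitary scalar, an element of $\mathcal{B}_{T'}$ with $T'=gTg^{-1}$. In particular, $\mathfrak{S}_O$ is closed under the discrete Fourier transform: for every $\varphi\in\mathfrak{S}_O$ the function $\widehat\varphi(w)=\frac{1}{\sqrt p}\sum_{t\in\mathbb{F}_p}e^{\frac{2\pi i}{p}wt}\varphi(t)$ is, up to multiplication by a unitary scalar, in $\mathfrak{S}_O$.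
   Context: Let $\mathcal{H}=\mathbb{C}(\mathbb{F}_p)$ with $\langle\phi,\varphi\rangle=\sum_t\phi(t)\overline{\varphi(t)}$, and $\psi(t)=e^{2\pi i t/p}$. Let $\mathsf{L}_\tau\varphi(t)=\varphi(t+\tau)$, $\mathsf{M}_w\varphi(t)=\psi(wt)\varphi(t)$. The Heisenberg group is $H=\mathbb{F}_p\times\mathbb{F}_p\times\mathbb{F}_p$ with $(\tau,w,z)(\tau',w',z')=(\tau+\tau',w+w',z+z'+\tfrac12(\tau w'-\tau'w))$, acting on $\mathcal{H}$ by the Heisenberg representation $\pi(\tau,w,z)=\psi(\tfrac12\tau w+z)\mathsf{M}_w\mathsf{L}_\tau$. The group $Sp=SL_2(\mathbb{F}_p)$ acts on $H$ through its linear action on the coordinates (column vector) $(\tau,w)$. The Weil representation $\rho:Sp\to U(\mathcal{H})$ is the unitary representation with $\rho(g)\pi(h)\rho(g)^{-1}=\pi(g(h))$ for all $g\in Sp$, $h\in H$ (unique if $p>3$; for $p=3$ take the one with $\mathrm{Tr}(\rho(g)\pi(-v))=\sigma_0(-\det(\kappa(g)+I))\,\psi(\tfrac14\omega(\kappa(g)v,v))$ for $v\in\mathbb{F}_p^2$ whenever $g-I$ is invertible, where $\omega((\tau,w),(\tau',w'))=\tau w'-\tau'w$, $\kappa(g)=(g+I)(g-I)^{-1}$, and $\sigma_0$ is the quadratic character of $\mathbb{F}_p^\times$). The element $\begin{pmatrix}0&1\\-1&0\end{pmatrix}$ acts, up to a unitary scalar, by the discrete Fourier transform. A (maximal) torus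 $T\subset Sp$ is the group of $\mathbb{F}_p$-points of a maximal algebraic torus defined over $\mathbb{F}_p$; it is split if conjugate to the diagonal subgroup and non-split otherwise. $T^\vee$ is its group of complex characters and $\sigma\in T^\vee$ the unique character of order 2. For $\chi\in T^\vee$ put $\mathcal{H}_\chi=\{\varphi:\rho(g)\varphi=\chi(g)\varphi\ \forall g\in T\}$; it is one-dimensional for $\chi\neq\sigma$. Choose unit vectors $\varphi_\chi\in\mathcal{H}_\chi$ and set $\mathcal{B}_T=\{\varphi_\chi:\chi\in T^\vee,\chi\neq\sigma\}$. *)

theory Defs
  imports
    "HOL-Analysis.Analysis"
    "HOL-Algebra.Algebraic_Closure_Type"
    "HOL-Number_Theory.Residues"
    "Berlekamp_Zassenhaus.Finite_Field"
begin

no_notation fps_nth (infixl "$" 75)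

text \<open>
  For \<open>'p :: prime_card\<close>, the type \<open>'p mod_ring\<close> is the prime field with \<open>CARD('p)\<close> elements.
  A function from that field to the complex numbers is a vector of type \<open>complex ^ 'p mod_ring\<close>.
\<close>

section \<open>The Hilbert space and the Heisenberg representation\<close>

type_synonym 'p hilb = "complex ^ 'p mod_ring"

definition cinner :: "'p::prime_card hilb \<Rightarrow> 'p hilb \<Rightarrow> complex" where
  "cinner \<phi> \<phi>' = (\<Sum>t\<in>UNIV. \<phi> $ t * cnj (\<phi>' $ t))"

definition unitary_op :: "('p::prime_card hilb \<Rightarrow> 'p hilb) \<Rightarrow> bool" where
  "unitary_op U \<longleftrightarrow> Vector_Spaces.linear (*s) (*s) U \<and> bij U \<and>
     (\<forall>\<phi> \<phi>'. cinner (U \<phi>) (U \<phi>') = cinner \<phi> \<phi>')"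

definition psi :: "'p::prime_card mod_ring \<Rightarrow> complex" where
  "psi t = exp (2 * of_real pi * \<i> * of_int (to_int_mod_ring t) / of_nat CARD('p))"

definition translation :: "'p::prime_card mod_ring \<Rightarrow> 'p hilb \<Rightarrow> 'p hilb" where
  "translation \<tau> \<phi> = (\<chi> t. \<phi> $ (t + \<tau>))"

definition modulation :: "'p::prime_card mod_ring \<Rightarrow> 'p hilb \<Rightarrow> 'p hilb" where
  "modulation w \<phi> = (\<chi> t. psi (w * t) * \<phi> $ t)"

type_synonym 'p heis = "'p mod_ring \<times> 'p mod_ring \<times> 'p mod_ring"

fun heis_rep :: "'p::prime_card heis \<Rightarrow> 'p hilb \<Rightarrow> 'p hilb" where
  "heis_rep (\<tau>, w, z) \<phi> = psi (1/2 * \<tau> * w + z) *s modulation w (translation \<tau> \<phi>)"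

section \<open>The group \<open>SL\<^sub>2\<close> and the Weil representation\<close>

definition SL2 :: "('k::field ^ 2 ^ 2) set" where
  "SL2 = {g. det g = 1}"

fun heis_act :: "'p::prime_card mod_ring ^ 2 ^ 2 \<Rightarrow> 'p heis \<Rightarrow> 'p heis" where
  "heis_act g (\<tau>, w, z) = ((g *v vector [\<tau>, w]) $ 1, (g *v vector [\<tau>, w]) $ 2, z)"

definition symp :: "'p::prime_card mod_ring ^ 2 \<Rightarrow> 'p mod_ring ^ 2 \<Rightarrow> 'p mod_ring" where
  "symp v v' = v $ 1 * v' $ 2 - v' $ 1 * v $ 2"

definition cayley :: "'p::prime_card mod_ring ^ 2 ^ 2 \<Rightarrow> 'p mod_ring ^ 2 ^ 2" where
  "cayley g = (g + mat 1) ** matrix_inv (g - mat 1)"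

definition quadratic_character :: "'p::prime_card mod_ring \<Rightarrow> complex" where
  "quadratic_character a = of_int (Legendre (to_int_mod_ring a) (int CARD('p)))"

definition op_trace :: "('p::prime_card hilb \<Rightarrow> 'p hilb) \<Rightarrow> complex" where
  "op_trace A = trace (matrix A)"

text \<open>
  The last conjunct only concerns \<open>p = 3\<close>, where the intertwining relation determines \<open>\<rho>\<close> only
  up to a character of \<open>SL\<^sub>2\<close>.  A vector \<open>v = (\<tau>, w)\<close> is regarded as the Heisenberg group element
  \<open>(\<tau>, w, 0)\<close>.
\<close>

definition weil_representation ::
  "('p::prime_card mod_ring ^ 2 ^ 2 \<Rightarrow> 'p hilb \<Rightarrow> 'p hilb) \<Rightarrow> bool" where
  "weil_representation \<rho> \<longleftrightarrow>
     (\<forall>g\<in>SL2. unitary_op (\<rho> g)) \<and>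
     (\<forall>g\<in>SL2. \<forall>g'\<in>SL2. \<rho> (g ** g') = \<rho> g \<circ> \<rho> g') \<and>
     (\<forall>g\<in>SL2. \<forall>h. \<rho> g \<circ> heis_rep h \<circ> inv_into UNIV (\<rho> g) = heis_rep (heis_act g h)) \<and>
     (CARD('p) = 3 \<longrightarrow>
       (\<forall>g\<in>SL2. invertible (g - mat 1) \<longrightarrow>
         (\<forall>v. op_trace (\<rho> g \<circ> heis_rep (- v $ 1, - v $ 2, 0)) =
              quadratic_character (- det (cayley g + mat 1)) *
              psi (1/4 * symp (cayley g *v v) v))))"

section \<open>Maximal tori\<close>

text \<open>
  Polynomial functions, with coefficients in the subring \<open>C\<close>, in the four entries of a matrix.
  Over an infinite field such functions are the same as formal polynomials.
\<close>

inductive_set polyfun :: "'k::field set \<Rightarrow> ('k ^ 2 ^ 2 \<Rightarrow> 'k) set" for C where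
  const: "c \<in> C \<Longrightarrow> (\<lambda>_. c) \<in> polyfun C"
| entry: "(\<lambda>M. M $ i $ j) \<in> polyfun C"
| add: "f \<in> polyfun C \<Longrightarrow> g \<in> polyfun C \<Longrightarrow> (\<lambda>M. f M + g M) \<in> polyfun C"
| mult: "f \<in> polyfun C \<Longrightarrow> g \<in> polyfun C \<Longrightarrow> (\<lambda>M. f M * g M) \<in> polyfun C"

definition zariski_closed :: "('k::field ^ 2 ^ 2) set \<Rightarrow> bool" where
  "zariski_closed S \<longleftrightarrow> (\<exists>P \<subseteq> polyfun UNIV. S = {M. \<forall>f\<in>P. f M = 0})"

definition zariski_connected :: "('k::field ^ 2 ^ 2) set \<Rightarrow> bool" where
  "zariski_connected S \<longleftrightarrow>
     \<not> (\<exists>A B. zariski_closed A \<and> zariski_closed B \<and> S \<subseteq> A \<union> B \<and>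
          A \<inter> B \<inter> S = {} \<and> A \<inter> S \<noteq> {} \<and> B \<inter> S \<noteq> {})"

definition SL2_subgroup :: "('k::field ^ 2 ^ 2) set \<Rightarrow> bool" where
  "SL2_subgroup S \<longleftrightarrow> S \<subseteq> SL2 \<and> mat 1 \<in> S \<and>
     (\<forall>g\<in>S. \<forall>h\<in>S. g ** h \<in> S) \<and> (\<forall>g\<in>S. matrix_inv g \<in> S)"

definition diagonalizable :: "('k::field ^ 2 ^ 2) set \<Rightarrow> bool" where
  "diagonalizable S \<longleftrightarrow>
     (\<exists>h :: 'k ^ 2 ^ 2. invertible h \<and> (\<forall>M\<in>S. \<forall>i j. i \<noteq> j \<longrightarrow> (matrix_inv h ** M ** h) $ i $ j = 0))"

text \<open>
  Over an algebraically closed field the algebraic tori are the connected diagonalizable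
  algebraic groups.
\<close>

definition algebraic_torus :: "('k::alg_closed_field ^ 2 ^ 2) set \<Rightarrow> bool" where
  "algebraic_torus S \<longleftrightarrow>
     SL2_subgroup S \<and> zariski_closed S \<and> zariski_connected S \<and> diagonalizable S"

definition maximal_algebraic_torus :: "('k::alg_closed_field ^ 2 ^ 2) set \<Rightarrow> bool" where
  "maximal_algebraic_torus S \<longleftrightarrow>
     algebraic_torus S \<and> (\<forall>S'. algebraic_torus S' \<longrightarrow> S \<subseteq> S' \<longrightarrow> S' = S)"

text \<open>
  A set is defined over the ground field if its vanishing ideal is generated by polynomials with
  coefficients in the ground field.
\<close>

definition defined_over_ground :: "('k::field alg_closure ^ 2 ^ 2) set \<Rightarrow> bool" where
  "defined_over_ground S \<longleftrightarrow>
     (\<forall>f\<in>polyfun UNIV. (\<forall>M\<in>S. f M = 0) \<longrightarrow>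
        (\<exists>(n::nat) a b.
           (\<forall>i<n. a i \<in> polyfun UNIV \<and> b i \<in> polyfun (range to_ac) \<and> (\<forall>M\<in>S. b i M = 0)) \<and>
           f = (\<lambda>M. \<Sum>i<n. a i M * b i M)))"

definition maximal_torus :: "('p::prime_card mod_ring ^ 2 ^ 2) set \<Rightarrow> bool" where
  "maximal_torus T \<longleftrightarrow>
     (\<exists>S. maximal_algebraic_torus S \<and> defined_over_ground S \<and> T = {M. map_matrix to_ac M \<in> S})"

definition conj_set :: "'k::field ^ 2 ^ 2 \<Rightarrow> ('k ^ 2 ^ 2) set \<Rightarrow> ('k ^ 2 ^ 2) set" where
  "conj_set g T = (\<lambda>M. g ** M ** matrix_inv g) ` T"

section \<open>Characters, eigenspaces and the oscillator system\<close>

text \<open>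
  Characters are extensional functions (constantly \<open>undefined\<close> outside \<open>T\<close>), so that each
  character is represented by exactly one function.
\<close>

definition torus_dual :: "('k::field ^ 2 ^ 2) set \<Rightarrow> ('k ^ 2 ^ 2 \<Rightarrow> complex) set" where
  "torus_dual T = {\<theta> \<in> T \<rightarrow>\<^sub>E - {0}. \<forall>g\<in>T. \<forall>h\<in>T. \<theta> (g ** h) = \<theta> g * \<theta> h}"

definition has_order_two :: "('k::field ^ 2 ^ 2) set \<Rightarrow> ('k ^ 2 ^ 2 \<Rightarrow> complex) \<Rightarrow> bool" where
  "has_order_two T \<theta> \<longleftrightarrow> (\<exists>g\<in>T. \<theta> g \<noteq> 1) \<and> (\<forall>g\<in>T. \<theta> g ^ 2 = 1)"

text \<open>
  The points of a maximal torus form a cyclic group of order \<open>p - 1\<close> or \<open>p + 1\<close>, so for odd \<open>p\<close>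
  exactly one character \<open>\<sigma>\<close> has order two, and this is the dual group without \<open>\<sigma>\<close>.
\<close>

definition nonquadratic_dual :: "('k::field ^ 2 ^ 2) set \<Rightarrow> ('k ^ 2 ^ 2 \<Rightarrow> complex) set" where
  "nonquadratic_dual T = {\<theta> \<in> torus_dual T. \<not> has_order_two T \<theta>}"

definition eigenspace ::
  "('p::prime_card mod_ring ^ 2 ^ 2 \<Rightarrow> 'p hilb \<Rightarrow> 'p hilb) \<Rightarrow> ('p mod_ring ^ 2 ^ 2) set \<Rightarrow>
   ('p mod_ring ^ 2 ^ 2 \<Rightarrow> complex) \<Rightarrow> 'p hilb set" where
  "eigenspace \<rho> T \<theta> = {\<phi>. \<forall>g\<in>T. \<rho> g \<phi> = \<theta> g *s \<phi>}"

type_synonym 'p eigvecs =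
  "('p mod_ring ^ 2 ^ 2) set \<Rightarrow> ('p mod_ring ^ 2 ^ 2 \<Rightarrow> complex) \<Rightarrow> 'p hilb"

definition unit_eigenvectors ::
  "('p::prime_card mod_ring ^ 2 ^ 2 \<Rightarrow> 'p hilb \<Rightarrow> 'p hilb) \<Rightarrow> 'p eigvecs \<Rightarrow> bool" where
  "unit_eigenvectors \<rho> ev \<longleftrightarrow>
     (\<forall>T. maximal_torus T \<longrightarrow> (\<forall>\<theta>\<in>nonquadratic_dual T.
        ev T \<theta> \<in> eigenspace \<rho> T \<theta> \<and> cinner (ev T \<theta>) (ev T \<theta>) = 1))"

definition torus_basis ::
  "'p::prime_card eigvecs \<Rightarrow> ('p mod_ring ^ 2 ^ 2) set \<Rightarrow> 'p hilb set" where
  "torus_basis ev T = ev T ` nonquadratic_dual T"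

definition oscillator_system :: "'p::prime_card eigvecs \<Rightarrow> 'p hilb set" where
  "oscillator_system ev = (\<Union>T\<in>{T. maximal_torus T}. torus_basis ev T)"

definition dft :: "'p::prime_card hilb \<Rightarrow> 'p hilb" where
  "dft \<phi> = (\<chi> w. 1 / of_real (sqrt (real CARD('p))) * (\<Sum>t\<in>UNIV. psi (w * t) * \<phi> $ t))"

definition in_up_to_phase :: "'p::prime_card hilb \<Rightarrow> 'p hilb set \<Rightarrow> bool" where
  "in_up_to_phase \<phi> B \<longleftrightarrow> (\<exists>c. cmod c = 1 \<and> c *s \<phi> \<in> B)"

end

theory Submission
  imports Defs "HOL-Combinatorics.Cycles"
begin

text \<open>
  Conjugation by \<open>g\<close> carries a maximal torus \<open>T\<close> and its characters to \<open>T' = g T g\<inverse>\<close>, and \<open>\<rho>(g)\<close>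
  carries eigenvectors to eigenvectors. So everything rests on the eigenspaces of the non-quadratic
  characters being lines.

  A maximal torus over the algebraic closure is conjugate to the diagonal one, hence it is the set of
  elements \<open>x + y J\<close> of determinant one for a traceless \<open>J\<close>. If it is stable under Frobenius, \<open>J\<close> can be
  rescaled to have entries in the prime field. So \<open>T = {x + y E. x\<^sup>2 - d y\<^sup>2 = 1}\<close> with \<open>E\<^sup>2 = d\<close>.

  If \<open>d\<close> is a square, \<open>T\<close> is conjugate to the diagonal torus, on which \<open>\<rho>(diag(a, 1/a))\<close> is
  \<open>\<phi>(t) \<mapsto> c(a) \<phi>(t / a)\<close> for a character \<open>c\<close>. For \<open>p > 3\<close> the determinant of \<open>\<rho>\<close> is trivial, so that
  \<open>c(a)\<close> is the sign of the permutation \<open>t \<mapsto> t / a\<close>; for \<open>p = 3\<close> the trace formula gives \<open>c(-1) = -1\<close>.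
  Thus \<open>c\<close> is the quadratic character, and eigenvectors for any other character vanish at \<open>0\<close>.

  If \<open>d\<close> is not a square, \<open>T\<close> is cyclic of order \<open>p + 1\<close> and each of the \<open>p\<close> non-quadratic characters has
  an eigenvector by hypothesis; these already exhaust the \<open>p\<close>-dimensional space.

  The Fourier transform intertwines the Heisenberg representation in the same way as \<open>\<rho>(w)\<close> does for
  the Weyl element \<open>w\<close>, hence it agrees with \<open>\<rho>(w)\<close> up to a phase.
\<close>

section \<open>Inverses, determinants and conjugation of two-by-two matrices\<close>

lemma matrix_inv_right:
  fixes A :: "'k::field ^ 2 ^ 2"
  assumes "invertible A"
  shows "A ** matrix_inv A = mat 1"
  using assms unfolding invertible_def matrix_inv_def by (metis (mono_tags, lifting) someI_ex)

lemma matrix_inv_left: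
  fixes A :: "'k::field ^ 2 ^ 2"
  assumes "invertible A"
  shows "matrix_inv A ** A = mat 1"
  using matrix_inv_right[OF assms] matrix_left_right_inverse by blast

lemma matrix_inv_unique:
  fixes A B :: "'k::field ^ 2 ^ 2"
  assumes "A ** B = mat 1"
  shows "matrix_inv A = B" "invertible A" "invertible B"
proof -
  have BA: "B ** A = mat 1" using assms matrix_left_right_inverse by blast
  show inv: "invertible A" "invertible B"
    using assms BA unfolding invertible_def by blast+
  have "matrix_inv A = matrix_inv A ** (A ** B)" using assms by simp
  also have "\<dots> = B" using matrix_inv_left[OF inv(1)] by (simp add: matrix_mul_assoc)
  finally show "matrix_inv A = B" .
qed

lemma matrix_inv_matrix_inv:
  fixes h :: "'k::field ^ 2 ^ 2"
  assumes "invertible h"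
  shows "matrix_inv (matrix_inv h) = h" "invertible (matrix_inv h)"
  using matrix_inv_unique[of "matrix_inv h" h] assms by (simp_all add: matrix_inv_left)

lemma SL2_invertible: "g \<in> SL2 \<Longrightarrow> invertible g"
  by (simp add: SL2_def invertible_det_nz)

lemma SL2_mult: "g \<in> SL2 \<Longrightarrow> h \<in> SL2 \<Longrightarrow> g ** h \<in> SL2"
  by (simp add: SL2_def det_mul)

lemma SL2_one: "mat 1 \<in> SL2"
  by (simp add: SL2_def)

lemma SL2_inverse:
  fixes g :: "'k::field ^ 2 ^ 2"
  assumes "g \<in> SL2"
  shows "matrix_inv g \<in> SL2"
proof -
  have "det g * det (matrix_inv g) = 1"
    using SL2_invertible[OF assms] by (metis det_I det_mul matrix_inv_right)
  then show ?thesis using assms by (simp add: SL2_def)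
qed

lemma det_conj:
  fixes h :: "'k::field ^ 2 ^ 2"
  assumes "invertible h"
  shows "det (h ** M ** matrix_inv h) = det M"
proof -
  have "det h * det (matrix_inv h) = 1" using assms by (metis det_I det_mul matrix_inv_right)
  then show ?thesis by (simp add: det_mul algebra_simps)
qed

lemma conj_cancel:
  fixes h :: "'k::field ^ 2 ^ 2"
  assumes "invertible h"
  shows "matrix_inv h ** (h ** M ** matrix_inv h) ** h = M"
    and "h ** (matrix_inv h ** M ** h) ** matrix_inv h = M"
proof -
  have "matrix_inv h ** (h ** M ** matrix_inv h) ** h
      = (matrix_inv h ** h) ** M ** (matrix_inv h ** h)"
    by (simp only: matrix_mul_assoc)
  then show "matrix_inv h ** (h ** M ** matrix_inv h) ** h = M"
    using assms by (simp add: matrix_inv_left)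
  have "h ** (matrix_inv h ** M ** h) ** matrix_inv h
      = (h ** matrix_inv h) ** M ** (h ** matrix_inv h)"
    by (simp only: matrix_mul_assoc)
  then show "h ** (matrix_inv h ** M ** h) ** matrix_inv h = M"
    using assms by (simp add: matrix_inv_right)
qed

lemma conj_mult:
  fixes h :: "'k::field ^ 2 ^ 2"
  assumes "invertible h"
  shows "(h ** M ** matrix_inv h) ** (h ** N ** matrix_inv h) = h ** (M ** N) ** matrix_inv h"
proof -
  have "(h ** M ** matrix_inv h) ** (h ** N ** matrix_inv h)
      = h ** M ** (matrix_inv h ** h) ** N ** matrix_inv h"
    by (simp only: matrix_mul_assoc)
  then show ?thesis using assms by (simp add: matrix_inv_left matrix_mul_assoc)
qed

lemma in_conj_set_iff:
  fixes h :: "'k::field ^ 2 ^ 2"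
  assumes "invertible h"
  shows "N \<in> conj_set h S \<longleftrightarrow> matrix_inv h ** N ** h \<in> S"
  unfolding conj_set_def using conj_cancel[OF assms] by (metis (no_types, lifting) imageE image_eqI)

lemma conj_set_conj_set_inv:
  fixes h :: "'k::field ^ 2 ^ 2"
  assumes "invertible h"
  shows "conj_set (matrix_inv h) (conj_set h S) = S" "conj_set h (conj_set (matrix_inv h) S) = S"
  using conj_cancel[OF assms]
  by (auto simp: in_conj_set_iff assms matrix_inv_matrix_inv[OF assms])

lemma conj_set_mono: "S \<subseteq> S' \<Longrightarrow> conj_set h S \<subseteq> conj_set h S'"
  unfolding conj_set_def by (rule image_mono)

section \<open>Conjugating tori\<close>

text \<open>Each entry of \<open>h ** M ** k\<close> is a linear form in the entries of
  \<open>M\<close>, with coefficients built from those of \<open>h\<close> and \<open>k\<close>.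
  Keeping \<open>C\<close> general covers both arbitrary and rational coefficients.\<close>

lemma polyfun_substitute:
  assumes "f \<in> polyfun C" "\<And>i j. h $ i $ j \<in> C" "\<And>i j. k $ i $ j \<in> C"
  shows "(\<lambda>M. f (h ** M ** k)) \<in> polyfun C"
  using assms(1)
proof induction
  case (entry i j)
  have "(\<lambda>M. (h ** M ** k) $ i $ j) =
    (\<lambda>M. ((h $ i $ 1 * M $ 1 $ 1 + h $ i $ 2 * M $ 2 $ 1) * k $ 1 $ j) +
         ((h $ i $ 1 * M $ 1 $ 2 + h $ i $ 2 * M $ 2 $ 2) * k $ 2 $ j))"
    by (simp add: matrix_matrix_mult_def sum_2)
  also have "\<dots> \<in> polyfun C"
    using assms(2,3) by (intro polyfun.intros) auto
  finally show ?case .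
qed (auto intro: polyfun.intros)

lemma zariski_closed_conj:
  assumes "invertible h" "zariski_closed S"
  shows "zariski_closed (conj_set h S)"
proof -
  obtain P where P: "P \<subseteq> polyfun UNIV" "S = {M. \<forall>f\<in>P. f M = 0}"
    using assms(2) unfolding zariski_closed_def by blast
  let ?P = "(\<lambda>f N. f (matrix_inv h ** N ** h)) ` P"
  have "?P \<subseteq> polyfun UNIV" using P(1) by (auto intro!: polyfun_substitute)
  moreover have "conj_set h S = {N. \<forall>f\<in>?P. f N = 0}"
    using in_conj_set_iff[OF assms(1)] P(2) by auto
  ultimately show ?thesis unfolding zariski_closed_def by blast
qed

lemma zariski_connected_conj:
  assumes h: "invertible h" and S: "zariski_connected S"
  shows "zariski_connected (conj_set h S)"
  unfolding zariski_connected_def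
proof (rule notI, elim exE conjE)
  fix A B
  \<comment> \<open>\<open>c\<close> pulls closed sets back along conjugation by \<open>h\<close>,
    turning a separation of the conjugate into one of \<open>S\<close>.\<close>
  define c where "c = conj_set (matrix_inv h)"
  have iff: "M \<in> c Y \<longleftrightarrow> h ** M ** matrix_inv h \<in> Y" for M Y
    using in_conj_set_iff[OF matrix_inv_matrix_inv(2)[OF h]] by (simp add: c_def matrix_inv_matrix_inv[OF h])
  have S': "M \<in> S \<longleftrightarrow> h ** M ** matrix_inv h \<in> conj_set h S" for M
    using in_conj_set_iff[OF h] conj_cancel[OF h] by simp
  assume "zariski_closed A" "zariski_closed B" and cov: "conj_set h S \<subseteq> A \<union> B"
    and disj: "A \<inter> B \<inter> conj_set h S = {}" and ne: "A \<inter> conj_set h S \<noteq> {}" "B \<inter> conj_set h S \<noteq> {}"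
  then have "zariski_closed (c A)" "zariski_closed (c B)"
    unfolding c_def using zariski_closed_conj matrix_inv_matrix_inv(2)[OF h] by blast+
  moreover have "S \<subseteq> c A \<union> c B" using cov iff S' by blast
  moreover have "c A \<inter> c B \<inter> S = {}" using disj iff S' by blast
  moreover have "c Y \<inter> S \<noteq> {}" if Y: "Y \<inter> conj_set h S \<noteq> {}" for Y
  proof -
    obtain N where "N \<in> Y" "N \<in> conj_set h S" using Y by blast
    then have "matrix_inv h ** N ** h \<in> c Y \<inter> S"
      using iff S' conj_cancel[OF h] by simp
    then show ?thesis by blast
  qed
  ultimately show False using S ne unfolding zariski_connected_def by meson
qed

lemma SL2_subgroup_conj:
  assumes h: "invertible h" and S: "SL2_subgroup S"
  shows "SL2_subgroup (conj_set h S)"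
proof -
  have one: "mat 1 \<in> conj_set h S"
    using S h in_conj_set_iff[OF h] by (simp add: SL2_subgroup_def matrix_inv_left)
  have sub: "conj_set h S \<subseteq> SL2"
    using S det_conj[OF h] by (auto simp: SL2_subgroup_def SL2_def conj_set_def)
  have mult: "g ** g' \<in> conj_set h S" if "g \<in> conj_set h S" "g' \<in> conj_set h S" for g g'
    using that S conj_mult[OF h] unfolding conj_set_def SL2_subgroup_def by blast
  have inv: "matrix_inv g \<in> conj_set h S" if g: "g \<in> conj_set h S" for g
  proof -
    obtain M where M: "M \<in> S" "g = h ** M ** matrix_inv h" using g unfolding conj_set_def by blast
    then have "M \<in> SL2" "matrix_inv M \<in> S" using S by (auto simp: SL2_subgroup_def)
    moreover have "matrix_inv g = h ** matrix_inv M ** matrix_inv h"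
    proof (rule matrix_inv_unique)
      show "g ** (h ** matrix_inv M ** matrix_inv h) = mat 1"
        using conj_mult[OF h] M(2) matrix_inv_right[OF SL2_invertible[OF \<open>M \<in> SL2\<close>]]
          matrix_inv_right[OF h] by simp
    qed
    ultimately show ?thesis unfolding conj_set_def by blast
  qed
  show ?thesis unfolding SL2_subgroup_def using one sub mult inv by blast
qed

text \<open>If \<open>k\<close> diagonalizes \<open>S\<close>, then \<open>h ** k\<close>
  diagonalizes its conjugate by \<open>h\<close>.\<close>

lemma diagonalizable_conj:
  fixes h :: "'a::field ^ 2 ^ 2"
  assumes h: "invertible h" and S: "diagonalizable S"
  shows "diagonalizable (conj_set h S)"
proof -
  from S[unfolded diagonalizable_def] obtain k :: "'a ^ 2 ^ 2" where kk: "invertible k \<and>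
    (\<forall>M\<in>S. \<forall>i j. i \<noteq> j \<longrightarrow> (matrix_inv k ** M ** k) $ i $ j = 0)" ..
  note k = conjunct1[OF kk] and diag = conjunct2[OF kk]
  have hk: "(h ** k) ** (matrix_inv k ** matrix_inv h) = mat 1"
  proof -
    have "(h ** k) ** (matrix_inv k ** matrix_inv h) = h ** (k ** matrix_inv k) ** matrix_inv h"
      by (simp only: matrix_mul_assoc)
    then show ?thesis using k h by (simp add: matrix_inv_right)
  qed
  have "(matrix_inv (h ** k) ** N ** (h ** k)) $ i $ j = 0" if "N \<in> conj_set h S" "i \<noteq> j" for N i j
  proof -
    have "matrix_inv (h ** k) ** N ** (h ** k) = matrix_inv k ** (matrix_inv h ** N ** h) ** k"
      unfolding matrix_inv_unique(1)[OF hk] by (simp only: matrix_mul_assoc)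
    then show ?thesis using that diag in_conj_set_iff[OF h] by simp
  qed
  then show ?thesis unfolding diagonalizable_def using matrix_inv_unique(2)[OF hk] by blast
qed

lemma algebraic_torus_conj:
  "invertible h \<Longrightarrow> algebraic_torus S \<Longrightarrow> algebraic_torus (conj_set h S)"
  unfolding algebraic_torus_def
  using SL2_subgroup_conj zariski_closed_conj zariski_connected_conj diagonalizable_conj by blast

lemma maximal_algebraic_torus_conj:
  assumes h: "invertible h" and S: "maximal_algebraic_torus S"
  shows "maximal_algebraic_torus (conj_set h S)"
  unfolding maximal_algebraic_torus_def
proof (intro conjI allI impI)
  show "algebraic_torus (conj_set h S)"
    using algebraic_torus_conj[OF h] S unfolding maximal_algebraic_torus_def by blast
  fix S' assume S': "algebraic_torus S'" "conj_set h S \<subseteq> S'"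
  \<comment> \<open>A torus above the conjugate pulls back to a torus above \<open>S\<close>, where
    maximality applies.\<close>
  have "S \<subseteq> conj_set (matrix_inv h) S'"
    using conj_set_mono[OF S'(2), of "matrix_inv h"] conj_set_conj_set_inv[OF h] by simp
  then have "conj_set (matrix_inv h) S' = S"
    using S S'(1) algebraic_torus_conj[OF matrix_inv_matrix_inv(2)[OF h]]
    unfolding maximal_algebraic_torus_def by blast
  then show "S' = conj_set h S" using conj_set_conj_set_inv[OF h] by metis
qed

section \<open>Base change from the ground field to its algebraic closure\<close>

lemma map_matrix_to_ac_mult:
  fixes A B :: "'k::field ^ 2 ^ 2"
  shows "map_matrix to_ac (A ** B) = map_matrix to_ac A ** map_matrix to_ac B"
  by (simp add: vec_eq_iff matrix_matrix_mult_def sum_2)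

lemma map_matrix_to_ac_mat: "map_matrix to_ac (mat c :: 'k::field ^ 2 ^ 2) = mat (to_ac c)"
  by (simp add: vec_eq_iff mat_def)

lemma map_matrix_to_ac_inverse:
  fixes g :: "'k::field ^ 2 ^ 2"
  assumes "invertible g"
  shows "matrix_inv (map_matrix to_ac g) = map_matrix to_ac (matrix_inv g)"
    and "invertible (map_matrix to_ac g)"
proof -
  have "map_matrix to_ac g ** map_matrix to_ac (matrix_inv g) = mat 1"
    using assms by (simp flip: map_matrix_to_ac_mult add: matrix_inv_right map_matrix_to_ac_mat)
  then show "matrix_inv (map_matrix to_ac g) = map_matrix to_ac (matrix_inv g)"
    and "invertible (map_matrix to_ac g)"
    by (rule matrix_inv_unique)+
qed

text \<open>The conjugating matrix and its inverse have entries in the ground field, so substituting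
  them keeps the rational generators rational.\<close>

lemma defined_over_ground_conj:
  fixes S :: "('k::field alg_closure ^ 2 ^ 2) set"
  assumes g: "invertible g" and S: "defined_over_ground S"
  shows "defined_over_ground (conj_set (map_matrix to_ac g) S)"
  unfolding defined_over_ground_def
proof (intro ballI impI)
  define h where "h = map_matrix to_ac g"
  have h: "invertible h" unfolding h_def using map_matrix_to_ac_inverse[OF g] by blast
  have rat: "h $ i $ j \<in> range to_ac" "matrix_inv h $ i $ j \<in> range to_ac" for i j
    unfolding h_def map_matrix_to_ac_inverse[OF g] by simp_all
  fix f :: "'k alg_closure ^ 2 ^ 2 \<Rightarrow> _"
  assume f: "f \<in> polyfun UNIV" and van: "\<forall>M\<in>conj_set (map_matrix to_ac g) S. f M = 0"
  let ?f = "\<lambda>M. f (h ** M ** matrix_inv h)"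
  have "?f \<in> polyfun UNIV" using f by (rule polyfun_substitute) auto
  moreover have "\<forall>M\<in>S. ?f M = 0" using van unfolding conj_set_def h_def by blast
  ultimately have "\<exists>(n::nat) a b. (\<forall>i<n. a i \<in> polyfun UNIV \<and> b i \<in> polyfun (range to_ac) \<and>
      (\<forall>M\<in>S. b i M = 0)) \<and> ?f = (\<lambda>M. \<Sum>i<n. a i M * b i M)"
    using S[unfolded defined_over_ground_def, THEN bspec, THEN mp, of ?f] by blast
  then obtain n :: nat and a b where
    ab: "\<forall>i<n. a i \<in> polyfun UNIV \<and> b i \<in> polyfun (range to_ac) \<and> (\<forall>M\<in>S. b i M = 0)"
    and eq: "?f = (\<lambda>M. \<Sum>i<n. a i M * b i M)"
    by blast
  define a' where "a' i = (\<lambda>N. a i (matrix_inv h ** N ** h))" for i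
  define b' where "b' i = (\<lambda>N. b i (matrix_inv h ** N ** h))" for i
  have "a' i \<in> polyfun UNIV" "b' i \<in> polyfun (range to_ac)" if "i < n" for i
    unfolding a'_def b'_def using ab that rat by (auto intro: polyfun_substitute)
  moreover have "\<forall>M\<in>conj_set h S. b' i M = 0" if "i < n" for i
    using ab that in_conj_set_iff[OF h] by (auto simp: b'_def)
  moreover have "f = (\<lambda>N. \<Sum>i<n. a' i N * b' i N)"
  proof
    fix N
    show "f N = (\<Sum>i<n. a' i N * b' i N)"
      using fun_cong[OF eq, of "matrix_inv h ** N ** h"] conj_cancel(2)[OF h] by (simp add: a'_def b'_def)
  qed
  ultimately show "\<exists>(n::nat) a b. (\<forall>i<n. a i \<in> polyfun UNIV \<and> b i \<in> polyfun (range to_ac) \<and>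
      (\<forall>M\<in>conj_set (map_matrix to_ac g) S. b i M = 0)) \<and> f = (\<lambda>M. \<Sum>i<n. a i M * b i M)"
    unfolding h_def[symmetric] by blast
qed

lemma maximal_torus_conj:
  fixes T :: "('p::prime_card mod_ring ^ 2 ^ 2) set"
  assumes g: "invertible g" and T: "maximal_torus T"
  shows "maximal_torus (conj_set g T)"
proof -
  obtain S where S: "maximal_algebraic_torus S" "defined_over_ground S" "T = {M. map_matrix to_ac M \<in> S}"
    using T unfolding maximal_torus_def by blast
  let ?h = "map_matrix to_ac g"
  have h: "invertible ?h" using map_matrix_to_ac_inverse[OF g] by blast
  have "conj_set g T = {M. map_matrix to_ac M \<in> conj_set ?h S}"
    using in_conj_set_iff[OF g] in_conj_set_iff[OF h] S(3)
    by (auto simp: map_matrix_to_ac_mult map_matrix_to_ac_inverse[OF g])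
  then show ?thesis
    unfolding maximal_torus_def
    using maximal_algebraic_torus_conj[OF h S(1)] defined_over_ground_conj[OF g S(2)] by blast
qed

section \<open>Algebraic tori over an algebraically closed field\<close>

definition diag2 :: "'k::field \<Rightarrow> 'k ^ 2 ^ 2" where
  "diag2 a = (\<chi> i j. if i = j then if i = 1 then a else 1 / a else 0)"

definition diag_torus :: "('k::field ^ 2 ^ 2) set" where
  "diag_torus = diag2 ` (- {0})"

text \<open>For a traceless \<open>J\<close> these are the elements \<open>x + y J\<close> of a two-dimensional commutative algebra.\<close>
definition plane :: "'k::field ^ 2 ^ 2 \<Rightarrow> 'k \<Rightarrow> 'k \<Rightarrow> 'k ^ 2 ^ 2" where
  "plane J x y = mat x + mat y ** J"

text \<open>For traceless \<open>J\<close> the determinant of x + y J is x^2 + y^2 det J, the norm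
  form of the quadratic algebra generated by \<open>J\<close>; hence the name.\<close>

definition norm_one :: "'k::field ^ 2 ^ 2 \<Rightarrow> ('k ^ 2 ^ 2) set" where
  "norm_one J = {M \<in> SL2. \<exists>x y. M = plane J x y}"

lemma matrix_mult_nth_2: "(A ** B) $ i $ j = A $ i $ 1 * B $ 1 $ j + A $ i $ (2::2) * B $ 2 $ j"
  by (simp add: matrix_matrix_mult_def sum_2)

lemma diag2_nth [simp]:
  "diag2 a $ 1 $ 1 = a" "diag2 a $ 1 $ 2 = 0" "diag2 a $ 2 $ 1 = 0" "diag2 a $ 2 $ 2 = 1 / a"
  by (simp_all add: diag2_def)

lemma plane_nth [simp]:
  "plane J x y $ i $ j = (if i = j then x else 0) + y * J $ i $ j"
  using exhaust_2[of i] exhaust_2[of j] by (auto simp: plane_def matrix_mult_nth_2 mat_def)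

lemma matrix_eq_iff_2:
  fixes A B :: "'k ^ 2 ^ 2"
  shows "A = B \<longleftrightarrow> A $ 1 $ 1 = B $ 1 $ 1 \<and> A $ 1 $ 2 = B $ 1 $ 2 \<and> A $ 2 $ 1 = B $ 2 $ 1 \<and> A $ 2 $ 2 = B $ 2 $ 2"
  by (auto simp: vec_eq_iff forall_2)

lemma diag_torus_iff:
  "M \<in> diag_torus \<longleftrightarrow> M \<in> SL2 \<and> M $ 1 $ 2 = 0 \<and> M $ 2 $ 1 = 0"
proof
  assume "M \<in> diag_torus"
  then show "M \<in> SL2 \<and> M $ 1 $ 2 = 0 \<and> M $ 2 $ 1 = 0"
    by (auto simp: diag_torus_def SL2_def det_2)
next
  assume M: "M \<in> SL2 \<and> M $ 1 $ 2 = 0 \<and> M $ 2 $ 1 = 0"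
  then have prod: "M $ 1 $ 1 * M $ 2 $ 2 = 1" by (auto simp: SL2_def det_2)
  then have "M $ 1 $ 1 \<noteq> 0" by auto
  with prod have "M $ 2 $ 2 = 1 / M $ 1 $ 1"
    by (intro eq_divide_imp) (simp_all add: mult.commute)
  have "M = diag2 (M $ 1 $ 1)" using M \<open>M $ 2 $ 2 = 1 / M $ 1 $ 1\<close> by (simp add: matrix_eq_iff_2)
  then show "M \<in> diag_torus" using \<open>M $ 1 $ 1 \<noteq> 0\<close> unfolding diag_torus_def by blast
qed

text \<open>Over a finite field the product of all X - a, plus 1, has positive degree but no
  root.\<close>

lemma infinite_alg_closed_field: "infinite (UNIV :: 'k::alg_closed_field set)"
proof
  assume fin: "finite (UNIV :: 'k set)"
  let ?P = "\<Prod>a\<in>(UNIV :: 'k set). [:- a, 1:]"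
  have deg: "Polynomial.degree ?P > 0"
    using fin by (subst degree_prod_eq_sum_degree) (auto simp: card_gt_0_iff)
  then have "Polynomial.degree (?P + 1) > 0"
    by (subst degree_add_eq_left) auto
  then obtain x where "poly (?P + 1) x = 0" using alg_closed_imp_poly_has_root by blast
  moreover have "poly ?P x = 0"
    using fin by (auto simp: poly_prod)
  ultimately show False by simp
qed

text \<open>On the diagonal torus the matrix entries are t, 1/t and 0, so a polynomial function
  becomes a Laurent polynomial; the factor \<open>t ^ n\<close> clears its denominators.\<close>

lemma polyfun_diag2_laurent:
  assumes "f \<in> polyfun UNIV"
  shows "\<exists>F n. \<forall>t. t \<noteq> 0 \<longrightarrow> t ^ n * f (diag2 t) = poly F t"
  using assms
proof induction
  case (const c)
  show ?case by (rule exI[of _ "[:c:]"], rule exI[of _ 0]) simp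
next
  case (entry i j)
  \<comment> \<open>One factor of t suffices for all four entries, the only denominator being that
    of 1/t.\<close>
  have "\<exists>F. \<forall>t. t \<noteq> 0 \<longrightarrow> t ^ 1 * diag2 t $ i $ j = poly F t"
    using exhaust_2[of i] exhaust_2[of j]
  proof (elim disjE, goal_cases)
    case 1 then show ?case by (intro exI[of _ "[:0, 0, 1:]"]) auto
  next
    case 2 then show ?case by (intro exI[of _ 0]) auto
  next
    case 3 then show ?case by (intro exI[of _ 0]) auto
  next
    case 4 then show ?case by (intro exI[of _ 1]) auto
  qed
  then show ?case by blast
next
  case (add f g)
  from add.IH(1) obtain F n where F: "\<forall>t. t \<noteq> 0 \<longrightarrow> t ^ n * f (diag2 t) = poly F t" by (elim exE)
  from add.IH(2) obtain G m where G: "\<forall>t. t \<noteq> 0 \<longrightarrow> t ^ m * g (diag2 t) = poly G t" by (elim exE)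
  have "t ^ (n + m) * (f (diag2 t) + g (diag2 t)) = poly ([:0, 1:] ^ m * F + [:0, 1:] ^ n * G) t"
    if "t \<noteq> 0" for t
  proof -
    have "t ^ (n + m) * (f (diag2 t) + g (diag2 t)) =
        t ^ m * (t ^ n * f (diag2 t)) + t ^ n * (t ^ m * g (diag2 t))"
      by (simp add: power_add algebra_simps)
    then show ?thesis using that by (simp add: F G)
  qed
  then show ?case by blast
next
  case (mult f g)
  from mult.IH(1) obtain F n where F: "\<forall>t. t \<noteq> 0 \<longrightarrow> t ^ n * f (diag2 t) = poly F t" by (elim exE)
  from mult.IH(2) obtain G m where G: "\<forall>t. t \<noteq> 0 \<longrightarrow> t ^ m * g (diag2 t) = poly G t" by (elim exE)
  have "t ^ (n + m) * (f (diag2 t) * g (diag2 t)) = poly (F * G) t"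
    if "t \<noteq> 0" for t
  proof -
    have "t ^ (n + m) * (f (diag2 t) * g (diag2 t)) =
        (t ^ n * f (diag2 t)) * (t ^ m * g (diag2 t))"
      by (simp add: power_add mult_ac)
    then show ?thesis using that by (simp add: F G)
  qed
  then show ?case by blast
qed

text \<open>The diagonal torus is even irreducible, because Laurent polynomials have no zero divisors.\<close>
lemma zariski_connected_diag_torus: "zariski_connected (diag_torus :: ('k::alg_closed_field ^ 2 ^ 2) set)"
  unfolding zariski_connected_def
proof (rule notI, elim exE conjE)
  fix A B :: "('k ^ 2 ^ 2) set"
  assume closed: "zariski_closed A" "zariski_closed B" and cov: "diag_torus \<subseteq> A \<union> B"
    and disj: "A \<inter> B \<inter> diag_torus = {}" and ne: "A \<inter> diag_torus \<noteq> {}" "B \<inter> diag_torus \<noteq> {}"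
  obtain a b where a: "a \<noteq> 0" "diag2 a \<in> A" "diag2 a \<notin> B" and b: "b \<noteq> 0" "diag2 b \<in> B" "diag2 b \<notin> A"
    using ne disj unfolding diag_torus_def by blast
  obtain f g where f: "f \<in> polyfun UNIV" "\<forall>M\<in>A. f M = 0" "f (diag2 b) \<noteq> 0"
    and g: "g \<in> polyfun UNIV" "\<forall>M\<in>B. g M = 0" "g (diag2 a) \<noteq> 0"
    using closed a b unfolding zariski_closed_def by blast
  from polyfun_diag2_laurent[OF f(1)] obtain F n where F: "\<forall>t. t \<noteq> 0 \<longrightarrow> t ^ n * f (diag2 t) = poly F t" by (elim exE)
  from polyfun_diag2_laurent[OF g(1)] obtain G m where G: "\<forall>t. t \<noteq> 0 \<longrightarrow> t ^ m * g (diag2 t) = poly G t" by (elim exE)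
  have "F \<noteq> 0" "G \<noteq> 0" using F b(1) G a(1) f(3) g(3) by auto
  then have "F * G \<noteq> 0" by simp
  \<comment> \<open>The two closed sets cover the torus, so every nonzero t is a root of
    \<open>F * G\<close>: too many for a nonzero polynomial.\<close>
  moreover have "- {0} \<subseteq> {t. poly (F * G) t = 0}"
  proof
    fix t :: 'k
    assume t: "t \<in> - {0}"
    then have "diag2 t \<in> A \<union> B" using cov unfolding diag_torus_def by blast
    then have "f (diag2 t) = 0 \<or> g (diag2 t) = 0" using f(2) g(2) by blast
    then show "t \<in> {t. poly (F * G) t = 0}" using F[rule_format, of t] G[rule_format, of t] t by auto
  qed
  ultimately have "finite (- {0 :: 'k})" using poly_roots_finite finite_subset by blast
  then have "finite (insert 0 (- {0 :: 'k}))" by blast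
  moreover have "insert 0 (- {0 :: 'k}) = UNIV" by auto
  ultimately show False using infinite_alg_closed_field by metis
qed

lemma zariski_closed_diag_torus: "zariski_closed (diag_torus :: ('k::field ^ 2 ^ 2) set)"
proof -
  \<comment> \<open>Subtraction is written through the constant -1 because \<open>polyfun\<close> is
    generated by sums and products.\<close>
  let ?P = "{\<lambda>M :: 'k ^ 2 ^ 2. M $ 1 $ 2, \<lambda>M. M $ 2 $ 1,
    \<lambda>M. (M $ 1 $ 1 * M $ 2 $ 2 + (- 1) * (M $ 1 $ 2 * M $ 2 $ 1)) + (- 1)}"
  have "?P \<subseteq> polyfun UNIV" by (intro insert_subsetI empty_subsetI polyfun.intros UNIV_I)
  moreover have "diag_torus = {M. \<forall>f\<in>?P. f M = 0}"
    by (auto simp: diag_torus_iff SL2_def det_2)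
  ultimately show ?thesis unfolding zariski_closed_def by blast
qed

lemma diag2_mult: "diag2 a ** diag2 b = diag2 (a * b)"
  by (simp add: matrix_eq_iff_2 matrix_mult_nth_2)

lemma diag2_one: "diag2 1 = mat 1"
  by (simp add: matrix_eq_iff_2 mat_def)

lemma diag2_inverse: "a \<noteq> 0 \<Longrightarrow> matrix_inv (diag2 a) = diag2 (1 / a)"
  by (rule matrix_inv_unique) (simp add: diag2_mult diag2_one)

lemma algebraic_torus_diag_torus: "algebraic_torus (diag_torus :: ('k::alg_closed_field ^ 2 ^ 2) set)"
  unfolding algebraic_torus_def
proof (intro conjI zariski_closed_diag_torus zariski_connected_diag_torus)
  have one: "mat 1 \<in> (diag_torus :: ('k ^ 2 ^ 2) set)"
    by (simp add: diag_torus_iff SL2_one) (simp add: mat_def)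
  show "SL2_subgroup (diag_torus :: ('k ^ 2 ^ 2) set)"
    unfolding SL2_subgroup_def using one
    by (auto simp: diag_torus_iff SL2_def diag2_mult diag2_inverse diag_torus_def)
       (auto simp: det_2)
  have "matrix_inv (mat 1) = (mat 1 :: 'k ^ 2 ^ 2)" by (rule matrix_inv_unique) simp
  moreover have "M $ i $ j = 0" if "M \<in> diag_torus" "i \<noteq> j" for M :: "'k ^ 2 ^ 2" and i j
    using that exhaust_2[of i] exhaust_2[of j] by (auto simp: diag_torus_iff)
  moreover have "invertible (mat 1 :: 'k ^ 2 ^ 2)" by (rule SL2_invertible[OF SL2_one])
  ultimately show "diagonalizable (diag_torus :: ('k ^ 2 ^ 2) set)"
    unfolding diagonalizable_def by (intro exI[of _ "mat 1"]) auto
qed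

text \<open>A diagonalizing matrix places \<open>S\<close> inside a conjugate of the diagonal torus.
  That conjugate is itself a torus, so maximality forces equality.\<close>

lemma maximal_algebraic_torus_eq_conj_diag:
  fixes S :: "('k::alg_closed_field ^ 2 ^ 2) set"
  assumes S: "maximal_algebraic_torus S"
  shows "\<exists>h. invertible h \<and> S = conj_set h diag_torus"
proof -
  have "algebraic_torus S" using S unfolding maximal_algebraic_torus_def by blast
  then have dS: "diagonalizable S" and sub: "S \<subseteq> SL2"
    unfolding algebraic_torus_def SL2_subgroup_def by blast+
  from dS[unfolded diagonalizable_def] obtain h :: "'k ^ 2 ^ 2" where hh: "invertible h \<and>
    (\<forall>M\<in>S. \<forall>i j. i \<noteq> j \<longrightarrow> (matrix_inv h ** M ** h) $ i $ j = 0)" ..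
  note h = conjunct1[OF hh]
  have "S \<subseteq> conj_set h diag_torus"
  proof
    fix M assume M: "M \<in> S"
    have "det (matrix_inv h ** M ** h) = det M"
      using det_conj[OF matrix_inv_matrix_inv(2)[OF h]] by (simp add: matrix_inv_matrix_inv[OF h])
    then have "matrix_inv h ** M ** h \<in> diag_torus"
      using hh M sub by (auto simp: diag_torus_iff SL2_def)
    then show "M \<in> conj_set h diag_torus" using in_conj_set_iff[OF h] by blast
  qed
  then have "conj_set h diag_torus = S"
    using S algebraic_torus_conj[OF h algebraic_torus_diag_torus] unfolding maximal_algebraic_torus_def by blast
  then show ?thesis using h by blast
qed

lemma mat_commute:
  fixes A :: "'k::field ^ 2 ^ 2"
  shows "mat y ** A = A ** mat y"
  by (simp add: vec_eq_iff forall_2 matrix_mult_nth_2 mat_def)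

lemma plane_conj:
  assumes "invertible h"
  shows "h ** plane J x y ** matrix_inv h = plane (h ** J ** matrix_inv h) x y"
proof -
  have "h ** plane J x y ** matrix_inv h = h ** mat x ** matrix_inv h + h ** (mat y ** J) ** matrix_inv h"
    by (simp add: plane_def matrix_add_ldistrib matrix_mul_assoc) (simp add: vec_eq_iff forall_2 matrix_mult_nth_2 algebra_simps)
  also have "h ** mat x ** matrix_inv h = mat x"
    using matrix_inv_right[OF assms] by (metis mat_commute matrix_mul_assoc matrix_mul_rid)
  also have "h ** (mat y ** J) ** matrix_inv h = mat y ** (h ** J ** matrix_inv h)"
    by (metis mat_commute matrix_mul_assoc)
  finally show ?thesis by (simp add: plane_def)
qed

lemma norm_one_conj:
  assumes h: "invertible h"
  shows "conj_set h (norm_one J) = norm_one (h ** J ** matrix_inv h)"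
proof -
  have 1: "matrix_inv h ** plane (h ** J ** matrix_inv h) x y ** h = plane J x y" for x y
    using plane_conj[OF h] conj_cancel[OF h] by metis
  have 2: "plane (h ** J ** matrix_inv h) x y \<in> SL2 \<longleftrightarrow> plane J x y \<in> SL2" for x y
    using det_conj[OF h] plane_conj[OF h] by (metis (no_types, lifting) SL2_def mem_Collect_eq)
  show ?thesis
  proof (intro Set.set_eqI iffI)
    fix N assume "N \<in> conj_set h (norm_one J)"
    then obtain x y where "plane J x y \<in> SL2" "N = h ** plane J x y ** matrix_inv h"
      unfolding conj_set_def norm_one_def by blast
    then show "N \<in> norm_one (h ** J ** matrix_inv h)"
      using 2 plane_conj[OF h] unfolding norm_one_def by auto
  next
    fix N assume "N \<in> norm_one (h ** J ** matrix_inv h)"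
    then show "N \<in> conj_set h (norm_one J)"
      using 1 2 unfolding in_conj_set_iff[OF h] norm_one_def by auto
  qed
qed

lemma diag_torus_eq_norm_one:
  fixes s :: "'k::field"
  assumes "(2::'k) \<noteq> 0" "K $ 1 $ 1 = s" "K $ 2 $ 2 = - s" "K $ 1 $ 2 = 0" "K $ 2 $ 1 = 0" "s \<noteq> 0"
  shows "diag_torus = norm_one K"
proof (intro Set.set_eqI iffI)
  fix M :: "'k ^ 2 ^ 2" assume "M \<in> diag_torus"
  then obtain a where a: "a \<noteq> 0" "M = diag2 a" unfolding diag_torus_def by blast
  have "(4::'k) = 2 * 2" by simp
  with assms(1) have "(4::'k) \<noteq> 0" by (metis mult_eq_0_iff)
  \<comment> \<open>The coefficients solve x + s y = a and x - s y = 1/a.\<close>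
  then have "M = plane K ((a + 1 / a) / 2) ((a - 1 / a) / (2 * s))"
    using a assms by (simp add: matrix_eq_iff_2 field_simps)
  moreover have "M \<in> SL2" using \<open>M \<in> diag_torus\<close> by (simp add: diag_torus_iff)
  ultimately show "M \<in> norm_one K" unfolding norm_one_def by blast
next
  fix M assume "M \<in> norm_one K"
  then show "M \<in> diag_torus" using assms by (auto simp: norm_one_def diag_torus_iff)
qed

text \<open>\<open>J\<close> is a conjugate of diag(t, 1/t) with t^2 = -1. This choice is traceless
  and has determinant one, so \<open>J\<close> is itself a point of the torus and Frobenius can be
  applied to it.\<close>

lemma maximal_algebraic_torus_eq_norm_one:
  fixes S :: "('k::alg_closed_field ^ 2 ^ 2) set"
  assumes S: "maximal_algebraic_torus S" and two: "(2::'k) \<noteq> 0"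
  shows "\<exists>J\<in>S. J $ 2 $ 2 = - J $ 1 $ 1 \<and> S = norm_one J"
proof -
  obtain h where h: "invertible h" "S = conj_set h diag_torus"
    using maximal_algebraic_torus_eq_conj_diag[OF S] by blast
  obtain t :: 'k where t: "t ^ 2 = - 1" using nth_root_exists[of 2 "- 1"] by auto
  then have t0: "t \<noteq> 0" by auto
  have ti: "1 / t = - t" using t t0 by (simp add: divide_eq_eq power2_eq_square)
  define J where "J = h ** diag2 t ** matrix_inv h"
  have "S = norm_one J"
    unfolding h(2) J_def norm_one_conj[OF h(1), symmetric]
    using diag_torus_eq_norm_one[of "diag2 t" t] two t0 ti by simp
  moreover have "J \<in> S" unfolding h(2) J_def conj_set_def diag_torus_def using t0 by blast
  moreover have "J $ 2 $ 2 = - J $ 1 $ 1"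
  proof -
    have "trace J = trace (diag2 t)"
      unfolding J_def using trace_mul_sym matrix_inv_left[OF h(1)]
      by (metis matrix_mul_assoc matrix_mul_rid)
    then have "J $ 1 $ 1 + J $ 2 $ 2 = 0" using ti by (simp add: trace_def sum_2)
    then show ?thesis by (simp add: eq_neg_iff_add_eq_0 add.commute)
  qed
  ultimately show ?thesis by blast
qed

section \<open>Maximal tori over the prime field\<close>

lemma mod_ring_two_neq_0:
  assumes "odd CARD('p::prime_card)"
  shows "(2 :: 'p mod_ring) \<noteq> 0"
proof
  assume "(2 :: 'p mod_ring) = 0"
  then have "of_nat 2 = (0 :: 'p mod_ring)" by simp
  then have "CARD('p) dvd 2" by (rule of_nat_0_mod_ring_dvd)
  then have "CARD('p) = 2" by (rule primes_dvd_imp_eq[OF prime_card two_is_prime_nat])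
  then show False using assms by simp
qed

lemma mod_ring_power_card:
  fixes x :: "'p::prime_card mod_ring"
  shows "x ^ CARD('p) = x"
  using finite_field_power_card_eq_same[of x] by simp

text \<open>X^p - X has at most p roots in the closure, and the p elements of the prime field are
  already roots.\<close>

lemma range_to_ac_iff_frobenius:
  fixes x :: "'p::prime_card mod_ring alg_closure"
  shows "x \<in> range to_ac \<longleftrightarrow> x ^ CARD('p) = x"
proof -
  let ?q = "Polynomial.monom 1 CARD('p) - Polynomial.monom 1 1 :: 'p mod_ring alg_closure poly"
  let ?R = "{x. poly ?q x = 0}"
  have p: "1 < CARD('p)" using prime_card[where 'a='p] prime_gt_1_nat by blast
  then have "Polynomial.coeff ?q CARD('p) = 1" by simp
  then have q: "?q \<noteq> 0" by (metis Polynomial.coeff_0 zero_neq_one)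
  have deg: "Polynomial.degree ?q \<le> CARD('p)"
    using p by (intro degree_diff_le) (auto simp: degree_monom_eq)
  have "card ?R \<le> card (range (to_ac :: 'p mod_ring \<Rightarrow> _))"
    using card_poly_roots_bound[OF q] deg by (simp add: card_image inj_to_ac)
  moreover have "range to_ac \<subseteq> ?R"
    by (auto simp: poly_monom mod_ring_power_card simp flip: to_ac_power)
  ultimately have "range to_ac = ?R" using card_seteq[OF poly_roots_finite[OF q]] by blast
  then show ?thesis by (auto simp: poly_monom)
qed

definition frobenius :: "'p::prime_card mod_ring alg_closure ^ 2 ^ 2 \<Rightarrow> 'p mod_ring alg_closure ^ 2 ^ 2" where
  "frobenius = map_matrix (\<lambda>x. x ^ CARD('p))"

text \<open>The p-th power map is a ring homomorphism in characteristic p and fixes the rational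
  coefficients.\<close>

lemma polyfun_frobenius:
  fixes M :: "'p::prime_card mod_ring alg_closure ^ 2 ^ 2"
  assumes "b \<in> polyfun (range to_ac)"
  shows "b (frobenius M) = b M ^ CARD('p)"
  using assms
proof induction
  case (const c)
  then show ?case using range_to_ac_iff_frobenius by metis
next
  case (add f g)
  have "(x + y) ^ CARD('p) = x ^ CARD('p) + y ^ CARD('p)" for x y :: "'p mod_ring alg_closure"
    by (rule freshmans_dream) (simp_all add: prime_card)
  then show ?case using add by simp
qed (simp_all add: frobenius_def power_mult_distrib)

text \<open>Each defining equation is a combination of rational functions vanishing on
  \<open>S\<close>, and the value of such a function at \<open>frobenius M\<close> is the p-th power
  of its value at \<open>M\<close>.\<close>

lemma frobenius_stable:
  fixes S :: "('p::prime_card mod_ring alg_closure ^ 2 ^ 2) set"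
  assumes "zariski_closed S" "defined_over_ground S" "M \<in> S"
  shows "frobenius M \<in> S"
proof -
  obtain P where P: "P \<subseteq> polyfun UNIV" "S = {M. \<forall>f\<in>P. f M = 0}"
    using assms(1) unfolding zariski_closed_def by blast
  have "f (frobenius M) = 0" if f: "f \<in> P" for f
  proof -
    have "f \<in> polyfun UNIV" "\<forall>M\<in>S. f M = 0" using P f by auto
    then have "\<exists>(n::nat) a b. (\<forall>i<n. a i \<in> polyfun UNIV \<and> b i \<in> polyfun (range to_ac) \<and>
        (\<forall>M\<in>S. b i M = 0)) \<and> f = (\<lambda>M. \<Sum>i<n. a i M * b i M)"
      using assms(2)[unfolded defined_over_ground_def, THEN bspec, THEN mp, of f] by blast
    then obtain n :: nat and a b where
      ab: "\<forall>i<n. a i \<in> polyfun UNIV \<and> b i \<in> polyfun (range to_ac) \<and> (\<forall>M\<in>S. b i M = 0)"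
      and eq: "f = (\<lambda>M. \<Sum>i<n. a i M * b i M)"
      by blast
    have "b i (frobenius M) = 0" if "i < n" for i
      using ab that assms(3) by (simp add: polyfun_frobenius)
    then show ?thesis unfolding eq by simp
  qed
  then show ?thesis using P(2) by blast
qed

lemma det_map_matrix_to_ac:
  fixes M :: "'k::field ^ 2 ^ 2"
  shows "det (map_matrix to_ac M) = to_ac (det M)"
  by (simp add: det_2)

text \<open>A traceless point \<open>J\<close> of the torus over the closure spans a Frobenius-stable line; scaling
  one entry of \<open>J\<close> to \<open>1\<close> makes it rational.\<close>
lemma maximal_torus_eq_norm_one:
  fixes T :: "('p::prime_card mod_ring ^ 2 ^ 2) set"
  assumes odd: "odd CARD('p)" and T: "maximal_torus T"
  shows "\<exists>E. E $ 2 $ 2 = - E $ 1 $ 1 \<and> det E \<noteq> 0 \<and> T = norm_one E"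
proof -
  let ?F = "to_ac :: 'p mod_ring \<Rightarrow> _"
  have two: "(2 :: 'p mod_ring) \<noteq> 0" by (rule mod_ring_two_neq_0[OF odd])
  have two': "(2 :: 'p mod_ring alg_closure) \<noteq> 0"
    using two to_ac_eq_0_iff[of "2 :: 'p mod_ring"] by simp
  obtain S where S: "maximal_algebraic_torus S" "defined_over_ground S" "T = {M. map_matrix to_ac M \<in> S}"
    using T unfolding maximal_torus_def by blast
  obtain J where J: "J \<in> S" "J $ 2 $ 2 = - J $ 1 $ 1" "S = norm_one J"
    using maximal_algebraic_torus_eq_norm_one[OF S(1) two'] by blast
  have detJ: "det J = 1" using J(1,3) by (simp add: norm_one_def SL2_def)
  have "zariski_closed S" using S(1) unfolding maximal_algebraic_torus_def algebraic_torus_def by blast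
  then have "frobenius J \<in> norm_one J" using frobenius_stable S(2) J(1,3) by blast
  then obtain x y where xy: "frobenius J = plane J x y" unfolding norm_one_def by blast
  have fr: "(J $ i $ j) ^ CARD('p) = plane J x y $ i $ j" for i j
    unfolding xy[symmetric] by (simp add: frobenius_def)
  \<comment> \<open>For odd p Frobenius preserves tracelessness, which kills the scalar part
    \<open>x\<close>.\<close>
  have "(- J $ 1 $ 1) ^ CARD('p) = - (J $ 1 $ 1 ^ CARD('p))"
    using odd by (simp add: power_minus_odd)
  then have "2 * x = 0" using fr[of 1 1] fr[of 2 2] J(2) by (simp add: algebra_simps)
  then have "x = 0" using two' by simp
  then have fr: "(J $ i $ j) ^ CARD('p) = y * J $ i $ j" for i j
    using fr[of i j] by simp
  have "\<exists>i j. J $ i $ j \<noteq> 0"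
    using detJ by (rule contrapos_pp) (simp add: det_2)
  then obtain i0 j0 where c0: "J $ i0 $ j0 \<noteq> 0" by blast
  define c where "c = J $ i0 $ j0"
  have c: "c \<noteq> 0" "c ^ CARD('p) = y * c" using c0 fr by (auto simp: c_def)
  then have y: "y \<noteq> 0" by auto
  \<comment> \<open>Frobenius multiplies every entry of \<open>J\<close> by the same
    \<open>y\<close>, so ratios of entries are fixed by it.\<close>
  have "J $ i $ j / c \<in> range ?F" for i j
    unfolding range_to_ac_iff_frobenius using c y by (simp add: power_divide fr)
  then have rat: "to_ac (of_ac (J $ i $ j / c)) = J $ i $ j / c" for i j
    by (rule to_ac_of_ac)
  define E where "E = map_matrix (\<lambda>u. of_ac (u / c) :: 'p mod_ring) J"
  have E: "to_ac (E $ i $ j) = J $ i $ j / c" for i j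
    unfolding E_def by (simp add: rat)
  have "to_ac (E $ 2 $ 2) = to_ac (- E $ 1 $ 1)"
    by (simp add: E J(2))
  then have trE: "E $ 2 $ 2 = - E $ 1 $ 1" by (simp only: to_ac_eq_iff)
  have "to_ac (det E) = det J / c ^ 2"
    by (simp add: det_2 E power2_eq_square diff_divide_distrib)
  then have detE: "det E \<noteq> 0" using detJ c by auto
  have E1: "E $ i0 $ j0 = 1"
    using E[of i0 j0] c by (simp add: c_def[symmetric])
  have plane_E: "map_matrix to_ac (plane E a b) = plane J (to_ac a) (to_ac b / c)" for a b
    by (simp add: vec_eq_iff E)
  have inj: "M = N" if "map_matrix to_ac M = map_matrix to_ac N" for M N :: "'p mod_ring ^ 2 ^ 2"
    using that by (simp add: vec_eq_iff)
  have sl: "map_matrix to_ac M \<in> SL2 \<longleftrightarrow> M \<in> SL2" for M :: "'p mod_ring ^ 2 ^ 2"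
    unfolding SL2_def by (simp add: det_map_matrix_to_ac)
  have "T = norm_one E"
  proof (intro Set.set_eqI iffI)
    fix M assume "M \<in> T"
    then have M: "map_matrix to_ac M \<in> SL2" "\<exists>x y. map_matrix to_ac M = plane J x y"
      using S(3) J(3) by (auto simp: norm_one_def)
    then obtain u v where uv: "map_matrix to_ac M = plane J u v" by blast
    then have ent: "to_ac (M $ i $ j) = (if i = j then u else 0) + v * J $ i $ j" for i j
      by (metis nth_map_matrix plane_nth)
    \<comment> \<open>Since \<open>J\<close> is traceless, the trace of \<open>M\<close> recovers
      \<open>u\<close> and shows that it is rational.\<close>
    have "2 * u = to_ac (M $ 1 $ 1 + M $ 2 $ 2)"
      by (simp add: ent J(2))
    then have "u = to_ac ((M $ 1 $ 1 + M $ 2 $ 2) / 2)"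
      using two' by (simp add: field_simps)
    then obtain a where a: "u = to_ac a" by blast
    \<comment> \<open>The entry at the normalizing position \<open>i0\<close>, \<open>j0\<close>
      recovers the other coefficient.\<close>
    have "v * c = to_ac (M $ i0 $ j0 - (if i0 = j0 then a else 0))"
      by (simp add: ent a c_def)
    then obtain b where "v * c = to_ac b" by blast
    then have b: "v = to_ac b / c" using c by (simp add: field_simps)
    have "map_matrix to_ac M = map_matrix to_ac (plane E a b)"
      unfolding plane_E uv a b ..
    then have "M = plane E a b" by (rule inj)
    then show "M \<in> norm_one E" using M(1) sl unfolding norm_one_def by blast
  next
    fix M assume "M \<in> norm_one E"
    then show "M \<in> T" unfolding S(3) J(3) norm_one_def using plane_E sl by auto
  qed
  then show ?thesis using trE detE by blast
qed

text \<open>\<open>E\<close> has the distinct eigenvalues s and -s; a matrix of eigenvectors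
  conjugates it to a diagonal one. It is rescaled into \<open>SL2\<close> because only there does
  \<rho> act.\<close>

lemma norm_one_split:
  fixes E :: "'k::field ^ 2 ^ 2"
  assumes two: "(2::'k) \<noteq> 0" and tr: "E $ 2 $ 2 = - E $ 1 $ 1" and s: "s ^ 2 = - det E" "s \<noteq> 0"
  shows "\<exists>h\<in>SL2. norm_one E = conj_set h diag_torus"
proof -
  define K :: "'k ^ 2 ^ 2" where "K = (\<chi> i j. if i = j then if i = 1 then s else - s else 0)"
  have K: "K $ 1 $ 1 = s" "K $ 2 $ 2 = - s" "K $ 1 $ 2 = 0" "K $ 2 $ 1 = 0" by (simp_all add: K_def)
  define a b c where "a = E $ 1 $ 1" and "b = E $ 1 $ 2" and "c = E $ 2 $ 1"
  have ss: "s * s = a * a + b * c" using s(1) by (simp add: det_2 tr power2_eq_square a_def b_def c_def)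
  have eig: ?thesis if "det h \<noteq> 0" "E ** h = h ** K" for h
  proof -
    \<comment> \<open>Scaling only the first eigenvector corrects the determinant; \<open>D\<close>
      is diagonal and so commutes with \<open>K\<close>.\<close>
    define D :: "'k ^ 2 ^ 2" where "D = (\<chi> i j. if i = j then if i = 1 then 1 / det h else 1 else 0)"
    have D: "D $ 1 $ 1 = 1 / det h" "D $ 2 $ 2 = 1" "D $ 1 $ 2 = 0" "D $ 2 $ 1 = 0" by (simp_all add: D_def)
    have "det D * det h = 1" using that(1) by (simp add: det_2[of D] D)
    then have hD: "h ** D \<in> SL2" by (simp add: SL2_def det_mul mult.commute)
    have "D ** K = K ** D" by (simp add: matrix_eq_iff_2 matrix_mult_nth_2 D K)
    then have "E ** (h ** D) = (h ** D) ** K" using that(2) by (metis matrix_mul_assoc)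
    then have "(h ** D) ** K ** matrix_inv (h ** D) = E"
      using matrix_inv_right[OF SL2_invertible[OF hD]] by (metis matrix_mul_assoc matrix_mul_rid)
    then have "norm_one E = conj_set (h ** D) (norm_one K)"
      using norm_one_conj[OF SL2_invertible[OF hD]] by metis
    then show ?thesis using hD diag_torus_eq_norm_one[OF two K(1,2,3,4) s(2)] by metis
  qed
  consider "b \<noteq> 0" | "c \<noteq> 0" | "b = 0" "c = 0" by blast
  then show ?thesis
  proof cases
    case 1
    \<comment> \<open>The columns (b, s - a) and (b, -s - a) are eigenvectors of \<open>E\<close>
      for s and -s.\<close>
    let ?h = "\<chi> i j. if i = 1 then b else if j = 1 then s - a else - s - a :: 'k ^ 2 ^ 2"
    have h: "?h $ 1 $ 1 = b" "?h $ 1 $ 2 = b" "?h $ 2 $ 1 = s - a" "?h $ 2 $ 2 = - s - a" by simp_all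
    have "det ?h = - 2 * b * s" unfolding det_2 h by (simp add: algebra_simps)
    moreover have "E ** ?h = ?h ** K"
      unfolding matrix_eq_iff_2 matrix_mult_nth_2 h K
      using ss by (simp add: tr algebra_simps flip: a_def b_def c_def)
    ultimately show ?thesis using eig[of ?h] 1 two s(2) by simp
  next
    case 2
    \<comment> \<open>Here the eigenvectors for s and -s are (s + a, c) and (a - s, c).\<close>
    let ?h = "\<chi> i j. if i = 2 then c else if j = 1 then s + a else a - s :: 'k ^ 2 ^ 2"
    have h: "?h $ 1 $ 1 = s + a" "?h $ 1 $ 2 = a - s" "?h $ 2 $ 1 = c" "?h $ 2 $ 2 = c" by simp_all
    have "det ?h = 2 * c * s" unfolding det_2 h by (simp add: algebra_simps)
    moreover have "E ** ?h = ?h ** K"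
      unfolding matrix_eq_iff_2 matrix_mult_nth_2 h K
      using ss by (simp add: tr algebra_simps flip: a_def b_def c_def)
    ultimately show ?thesis using eig[of ?h] 2 two s(2) by simp
  next
    case 3
    then have "a \<noteq> 0" using ss s(2) by auto
    then have "norm_one E = diag_torus"
      using diag_torus_eq_norm_one[of E a] two 3 tr by (simp add: a_def b_def c_def)
    moreover have "conj_set (mat 1) diag_torus = (diag_torus :: ('k ^ 2 ^ 2) set)"
      unfolding conj_set_def matrix_inv_unique(1)[OF matrix_mul_lid] by simp
    ultimately show ?thesis using SL2_one by metis
  qed
qed

section \<open>The Weil representation\<close>

text \<open>\<open>psi\<close> is defined through representatives in {0..p-1}; their sum must be
  reduced mod p, which leaves the exponential unchanged.\<close>

lemma psi_add: "psi (a + b) = psi a * psi (b :: 'p::prime_card mod_ring)"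
proof -
  let ?p = "int CARD('p)"
  let ?e = "\<lambda>n::int. exp (2 * of_real pi * \<i> * of_int n / of_nat CARD('p)) :: complex"
  have p: "CARD('p) > 0" by simp
  have e_mult: "?e (m + n) = ?e m * ?e n" for m n
    by (simp add: add_divide_distrib distrib_left flip: exp_add)
  have "?e (?p * k) = 1" for k
  proof -
    have "?e (?p * k) = exp (of_int k * (2 * of_real pi * \<i>))" by (simp add: algebra_simps)
    then show ?thesis by (simp add: exp_eq_1)
  qed
  then have e_mod: "?e (m mod ?p) = ?e m" for m
    using e_mult[of "?p * (m div ?p)" "m mod ?p"] by simp
  have "to_int_mod_ring (a + b) = (to_int_mod_ring a + to_int_mod_ring b) mod ?p"
    by transfer simp
  then show ?thesis unfolding psi_def using e_mod e_mult by simp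
qed

lemma psi_0 [simp]: "psi (0 :: 'p::prime_card mod_ring) = 1"
  by (simp add: psi_def)

lemma psi_neq_0 [simp]: "psi (a :: 'p::prime_card mod_ring) \<noteq> 0"
  by (simp add: psi_def)

text \<open>exp(2 pi i n / p) = 1 forces p to divide n, and the chosen representative lies in
  {0..p-1}.\<close>

lemma psi_eq_1_iff: "psi (a :: 'p::prime_card mod_ring) = 1 \<longleftrightarrow> a = 0"
proof
  assume 1: "psi a = 1"
  let ?n = "to_int_mod_ring a"
  have n: "0 \<le> ?n" "?n < int CARD('p)" using range_to_int_mod_ring[where 'a='p] by auto
  have "psi a = exp (\<i> * of_real (2 * pi * of_int ?n / real CARD('p)))"
    unfolding psi_def by (simp add: field_simps)
  then obtain k :: int where "2 * pi * of_int ?n / real CARD('p) = of_int (2 * k) * pi"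
    using 1 by (auto simp: exp_eq_1)
  then have "real_of_int ?n = of_int k * real CARD('p)" by (simp add: field_simps)
  then have "?n = k * int CARD('p)" by (metis of_int_eq_iff of_int_mult of_int_of_nat_eq)
  then have "?n = 0" using n by (metis dvd_triv_right zdvd_not_zless order_le_less)
  then show "a = 0" by simp
qed simp

lemma psi_eq_iff: "psi a = psi b \<longleftrightarrow> a = (b :: 'p::prime_card mod_ring)"
proof -
  have "psi (a - b) * psi b = psi a" by (simp flip: psi_add)
  then have "psi a = psi b \<longleftrightarrow> psi (a - b) = 1" by auto
  then show ?thesis by (simp add: psi_eq_1_iff)
qed

lemma heis_rep_translation: "heis_rep (\<tau>, 0, 0) \<phi> $ t = \<phi> $ (t + \<tau>)"
  by (simp add: modulation_def translation_def)

lemma heis_rep_modulation: "heis_rep (0, w, 0) \<phi> $ t = psi (w * t) * \<phi> $ t"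
  by (simp add: modulation_def translation_def)

section \<open>The inner product and unitary operators\<close>

lemma cinner_add_left: "cinner (u + v) w = cinner u w + cinner v w"
  by (simp add: cinner_def distrib_right sum.distrib)

lemma cinner_scale_left: "cinner (c *s u) w = c * cinner u w"
  by (simp add: cinner_def sum_distrib_left mult_ac)

lemma cinner_scale_right: "cinner u (c *s w) = cnj c * cinner u w"
  by (simp add: cinner_def sum_distrib_left mult_ac)

lemma cinner_sum_left: "cinner (sum f A) w = (\<Sum>i\<in>A. cinner (f i) w)"
  by (induction A rule: infinite_finite_induct) (simp_all add: cinner_add_left, simp_all add: cinner_def)

lemma cinner_self: "cinner u u = of_real (\<Sum>t\<in>UNIV. (cmod (u $ t))\<^sup>2)"
  by (simp add: cinner_def complex_norm_square[symmetric] flip: of_real_power)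

lemma cinner_self_eq_0_iff: "cinner u u = 0 \<longleftrightarrow> u = 0"
  unfolding cinner_self of_real_eq_0_iff by (simp add: sum_nonneg_eq_0_iff vec_eq_iff)

lemma unitary_op_linear:
  assumes "unitary_op U"
  shows "U (u + v) = U u + U v" "U (c *s u) = c *s U u" "U (sum f A) = (\<Sum>i\<in>A. U (f i))" "U 0 = 0"
    and "Vector_Spaces.linear (*s) (*s) U"
proof -
  show l: "Vector_Spaces.linear (*s) (*s) U" using assms by (simp add: unitary_op_def)
  show "U (u + v) = U u + U v" "U (c *s u) = c *s U u" "U (sum f A) = (\<Sum>i\<in>A. U (f i))" "U 0 = 0"
    by (rule vec.linear_add[OF l] vec.linear_scale[OF l] vec.linear_sum[OF l] vec.linear_0[OF l])+
qed

locale weil =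
  fixes \<rho> :: "'p::prime_card mod_ring ^ 2 ^ 2 \<Rightarrow> 'p hilb \<Rightarrow> 'p hilb"
  assumes weil: "weil_representation \<rho>"
begin

lemma unitary: "g \<in> SL2 \<Longrightarrow> unitary_op (\<rho> g)"
  using weil by (simp add: weil_representation_def)

lemmas linear = unitary_op_linear[OF unitary]

lemma cinner_rho: "g \<in> SL2 \<Longrightarrow> cinner (\<rho> g u) (\<rho> g v) = cinner u v"
  using unitary by (simp add: unitary_op_def)

lemma rho_mult: "g \<in> SL2 \<Longrightarrow> h \<in> SL2 \<Longrightarrow> \<rho> (g ** h) \<phi> = \<rho> g (\<rho> h \<phi>)"
  using weil by (simp add: weil_representation_def)

lemma rho_one: "\<rho> (mat 1) \<phi> = \<phi>"
proof -
  have "\<rho> (mat 1) (\<rho> (mat 1) \<phi>) = \<rho> (mat 1) \<phi>" using rho_mult[OF SL2_one SL2_one] by simp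
  moreover have "inj (\<rho> (mat 1))" using unitary[OF SL2_one] by (simp add: unitary_op_def bij_def)
  ultimately show ?thesis by (simp add: inj_eq)
qed

lemma rho_inverse:
  assumes "g \<in> SL2"
  shows "\<rho> (matrix_inv g) (\<rho> g \<phi>) = \<phi>" "\<rho> g (\<rho> (matrix_inv g) \<phi>) = \<phi>"
  using assms SL2_inverse[OF assms] SL2_invertible[OF assms] rho_one
  by (simp_all flip: rho_mult add: matrix_inv_left matrix_inv_right)

lemma rho_heis:
  assumes "g \<in> SL2"
  shows "\<rho> g (heis_rep h \<phi>) = heis_rep (heis_act g h) (\<rho> g \<phi>)"
proof -
  have "\<rho> g \<circ> heis_rep h \<circ> inv_into UNIV (\<rho> g) = heis_rep (heis_act g h)"
    using weil assms unfolding weil_representation_def by blast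
  moreover have "inv_into UNIV (\<rho> g) (\<rho> g \<phi>) = \<phi>"
    using unitary[OF assms] by (simp add: unitary_op_def bij_def)
  ultimately show ?thesis by (metis comp_apply)
qed

lemma rho_expand:
  assumes "g \<in> SL2"
  shows "\<rho> g \<phi> $ s = (\<Sum>t\<in>UNIV. \<phi> $ t * \<rho> g (axis t 1) $ s)"
proof -
  have "\<rho> g \<phi> = (\<Sum>t\<in>UNIV. \<phi> $ t *s \<rho> g (axis t 1))"
    by (subst basis_expansion[symmetric]) (simp only: linear[OF assms])
  then show ?thesis by simp
qed

text \<open>Intertwining with modulations puts the image of a delta function at a single point;
  intertwining with translations makes the scalar independent of that point.\<close>
lemma rho_diag2:
  assumes a: "a \<noteq> 0"
  shows "\<exists>c. \<forall>\<phi> t. \<rho> (diag2 a) \<phi> $ t = c * \<phi> $ (t / a)"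
proof -
  have g: "diag2 a \<in> SL2" using a by (simp add: SL2_def det_2)
  let ?U = "\<rho> (diag2 a)"
  have act: "heis_act (diag2 a) (\<tau>, w, z) = (a * \<tau>, w / a, z)" for \<tau> w z
    by (simp add: matrix_vector_mult_def sum_2)
  have supp: "?U (axis t 1) $ s = 0" if "s \<noteq> a * t" for s t
  proof (rule ccontr)
    assume nz: "?U (axis t 1) $ s \<noteq> 0"
    \<comment> \<open>A delta function is a modulation eigenvector with eigenvalue
      \<open>psi t\<close>. Its image has the same eigenvalue for modulation by 1/a, and
      \<open>psi\<close> is injective.\<close>
    have "heis_rep (0, 1, 0) (axis t 1) = psi t *s axis t 1"
      by (simp add: vec_eq_iff heis_rep_modulation axis_def del: heis_rep.simps)
    then have "psi t *s ?U (axis t 1) = heis_rep (0, 1 / a, 0) (?U (axis t 1))"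
      using rho_heis[OF g, of "(0, 1, 0)" "axis t 1"] by (simp add: act linear[OF g] del: heis_rep.simps heis_act.simps)
    then have "psi t * ?U (axis t 1) $ s = psi (1 / a * s) * ?U (axis t 1) $ s"
      by (metis heis_rep_modulation vector_smult_component)
    then have "t = s / a" using nz by (simp add: psi_eq_iff)
    then show False using that a by simp
  qed
  have trans: "?U (axis t 1) $ (a * t) = ?U (axis 0 1) $ 0" for t
  proof -
    have "heis_rep (- t, 0, 0) (axis 0 1) = axis t 1"
      by (auto simp add: vec_eq_iff heis_rep_translation axis_def simp del: heis_rep.simps)
    then have "?U (axis t 1) = heis_rep (- (a * t), 0, 0) (?U (axis 0 1))"
      using rho_heis[OF g, of "(- t, 0, 0)" "axis 0 1"] by (simp add: act del: heis_rep.simps heis_act.simps)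
    then show ?thesis by (simp add: heis_rep_translation del: heis_rep.simps)
  qed
  have "?U \<phi> $ s = ?U (axis 0 1) $ 0 * \<phi> $ (s / a)" for \<phi> s
  proof -
    have "?U \<phi> $ s = (\<Sum>t\<in>UNIV. if t = s / a then \<phi> $ t * ?U (axis 0 1) $ 0 else 0)"
      unfolding rho_expand[OF g, of \<phi>]
    proof (rule sum.cong)
      fix t
      show "\<phi> $ t * ?U (axis t 1) $ s = (if t = s / a then \<phi> $ t * ?U (axis 0 1) $ 0 else 0)"
      proof (cases "t = s / a")
        case True
        then have "s = a * t" using a by simp
        then show ?thesis using trans[of t] True by simp
      next
        case False
        then have "s \<noteq> a * t" using a by auto
        then show ?thesis using supp False by simp
      qed
    qed simp
    then show ?thesis by simp
  qed
  then show ?thesis by blast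
qed

text \<open>The scalar c(a) in the action of diag(a, 1/a), read off at 0, the point fixed by every t
  -> t / a.\<close>

definition torus_char :: "'p mod_ring \<Rightarrow> complex" where
  "torus_char a = \<rho> (diag2 a) (axis 0 1) $ 0"

lemma rho_diag2_eq:
  assumes "a \<noteq> 0"
  shows "\<rho> (diag2 a) \<phi> $ t = torus_char a * \<phi> $ (t / a)"
proof -
  obtain c where c: "\<And>\<phi> t. \<rho> (diag2 a) \<phi> $ t = c * \<phi> $ (t / a)"
    using rho_diag2[OF assms] by blast
  then have "torus_char a = c" by (simp add: torus_char_def)
  then show ?thesis using c by simp
qed

lemma diag2_SL2: "a \<noteq> 0 \<Longrightarrow> diag2 a \<in> SL2"
  by (simp add: SL2_def det_2)

lemma torus_char_mult:
  assumes "a \<noteq> 0" "b \<noteq> 0"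
  shows "torus_char (a * b) = torus_char a * torus_char b"
proof -
  have "\<rho> (diag2 (a * b)) (axis 0 1) $ 0 = \<rho> (diag2 a) (\<rho> (diag2 b) (axis 0 1)) $ 0"
    using assms by (simp add: rho_mult diag2_SL2 flip: diag2_mult)
  then show ?thesis using assms by (simp add: rho_diag2_eq)
qed

lemma torus_char_1: "torus_char 1 = 1"
  by (simp add: torus_char_def diag2_one rho_one)

lemma torus_char_power: "a \<noteq> 0 \<Longrightarrow> torus_char (a ^ n) = torus_char a ^ n"
  by (induction n) (simp_all add: torus_char_1 torus_char_mult)

text \<open>The Weyl element with rows (0, 1) and (-1, 0).\<close>

definition fourier_matrix :: "'p mod_ring ^ 2 ^ 2" where
  "fourier_matrix = (\<chi> i j. if i = j then 0 else if i = 1 then 1 else - 1)"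

lemma fourier_matrix_SL2: "fourier_matrix \<in> SL2"
  by (simp add: fourier_matrix_def SL2_def det_2)

text \<open>The delta at 0 is invariant under modulations, so its image is invariant under
  translations, hence constant. Translating the delta modulates that constant, which produces the
  Fourier kernel.\<close>

lemma rho_fourier: "\<exists>c. cmod c = 1 \<and> (\<forall>\<phi>. \<rho> fourier_matrix \<phi> = c *s dft \<phi>)"
proof -
  let ?U = "\<rho> fourier_matrix" and ?q = "sqrt (real CARD('p))"
  note g = fourier_matrix_SL2
  have act: "heis_act fourier_matrix (\<tau>, w, z) = (w, - \<tau>, z)" for \<tau> w z
    by (simp add: matrix_vector_mult_def sum_2 fourier_matrix_def)
  define k where "k = ?U (axis 0 1) $ 0"
  have const: "?U (axis 0 1) $ s = k" for s
  proof -
    have "heis_rep (0, s, 0) (axis 0 1) = axis 0 1"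
      by (simp add: vec_eq_iff heis_rep_modulation axis_def del: heis_rep.simps)
    then have "?U (axis 0 1) = heis_rep (s, 0, 0) (?U (axis 0 1))"
      using rho_heis[OF g, of "(0, s, 0)" "axis 0 1"] by (simp add: act del: heis_rep.simps heis_act.simps)
    then have "?U (axis 0 1) $ 0 = ?U (axis 0 1) $ (0 + s)" by (metis heis_rep_translation)
    then show ?thesis by (simp add: k_def)
  qed
  have delta: "?U (axis t 1) $ s = psi (t * s) * k" for t s
  proof -
    have "heis_rep (- t, 0, 0) (axis 0 1) = axis t 1"
      by (auto simp add: vec_eq_iff heis_rep_translation axis_def simp del: heis_rep.simps)
    then have "?U (axis t 1) = heis_rep (0, t, 0) (?U (axis 0 1))"
      using rho_heis[OF g, of "(- t, 0, 0)" "axis 0 1"] by (simp add: act del: heis_rep.simps heis_act.simps)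
    then show ?thesis by (simp add: heis_rep_modulation const del: heis_rep.simps)
  qed
  have q: "?q > 0" by simp
  have "?U \<phi> = (k * of_real ?q) *s dft \<phi>" for \<phi>
  proof -
    have "?U \<phi> $ s = ((k * of_real ?q) *s dft \<phi>) $ s" for s
      unfolding rho_expand[OF g, of \<phi>]
      using q by (simp add: delta dft_def sum_distrib_left mult_ac)
    then show ?thesis by (simp add: vec_eq_iff)
  qed
  \<comment> \<open>The constant vector \<open>k\<close> has squared norm p |k|^2, which must equal
    that of the delta at 0.\<close>
  moreover have "cmod (k * of_real ?q) = 1"
  proof -
    have "cinner (axis 0 1 :: 'p hilb) (axis 0 1) = 1"
      by (simp add: cinner_def axis_def if_distrib cong: if_cong)
    then have "cinner (?U (axis 0 1)) (?U (axis 0 1)) = 1" by (simp only: cinner_rho[OF g])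
    then have "(\<Sum>t\<in>(UNIV :: 'p mod_ring set). (cmod k)\<^sup>2) = 1"
      by (simp only: cinner_self const of_real_eq_1_iff)
    then have "real CARD('p) * (cmod k)\<^sup>2 = 1" by simp
    then have "(cmod (k * of_real ?q))\<^sup>2 = 1" by (simp add: norm_mult power_mult_distrib mult.commute)
    then show ?thesis using norm_ge_zero[of "k * of_real ?q"] by (simp only: power2_eq_1_iff) linarith
  qed
  ultimately show ?thesis by blast
qed

end

section \<open>The character of the diagonal torus\<close>

text \<open>The field is repackaged as a ring record, to which the cyclicity of the multiplicative
  group of a finite field applies.\<close>

lemma generator_mod_ring:
  "\<exists>a :: 'p::prime_card mod_ring. a \<noteq> 0 \<and> (\<forall>u. u \<noteq> 0 \<longrightarrow> (\<exists>i. u = a ^ i))"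
proof -
  let ?R = "ring_of_type_algebra :: 'p mod_ring ring"
  interpret R: Ring.field ?R by (rule field_from_type_algebra)
  have pow: "a [^]\<^bsub>?R\<^esub> (i::nat) = a ^ i" for a i
    by (induction i) (simp_all add: ring_of_type_algebra_def)
  have car: "carrier (Multiplicative_Group.mult_of ?R) = - {0}"
    by (auto simp: Multiplicative_Group.carrier_mult_of ring_of_type_algebra_def)
  have "finite (carrier ?R)" by simp
  from R.finite_field_mult_group_has_gen[OF this] obtain a where a: "a \<in> carrier (Multiplicative_Group.mult_of ?R)"
    "carrier (Multiplicative_Group.mult_of ?R) = {a [^]\<^bsub>?R\<^esub> i | i::nat. i \<in> UNIV}"
    by (elim bexE)
  then show ?thesis unfolding car pow by blast
qed

text \<open>Each further entry of the list contributes one transposition.\<close>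

lemma sign_cycle_of_list: "distinct (x # xs) \<Longrightarrow> sign (cycle_of_list (x # xs)) = (- 1) ^ length xs"
proof (induction xs arbitrary: x)
  case (Cons y ys)
  have "sign (cycle_of_list (x # y # ys)) = sign (Transposition.transpose x y) * sign (cycle_of_list (y # ys))"
    using permutation_of_cycle[of "y # ys"] by (simp add: sign_compose permutation_swap_id)
  then show ?case using Cons by (auto simp: sign_swap_id comp_def)
qed simp

text \<open>Multiplication by a generator is a cycle of even length \<open>p - 1\<close>.\<close>
lemma sign_mult_generator:
  assumes odd: "odd CARD('p::prime_card)"
    and a: "(a :: 'p mod_ring) \<noteq> 0" "\<And>u. u \<noteq> 0 \<Longrightarrow> \<exists>i. u = a ^ i"
  shows "sign (\<lambda>t. a * t) = - 1"
proof -
  let ?n = "CARD('p) - 1"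
  have p: "CARD('p) > 1" using prime_card[where 'a='p] prime_gt_1_nat by blast
  have "a * a ^ ?n = a * 1"
    using mod_ring_power_card[of a] p by (simp flip: power_Suc)
  then have an: "a ^ ?n = 1" using a(1) by simp
  have amod: "a ^ i = a ^ (i mod ?n)" for i
  proof -
    have "a ^ (?n * (i div ?n) + i mod ?n) = a ^ (i mod ?n)"
      by (simp only: power_add power_mult an power_one mult_1)
    then show ?thesis by simp
  qed
  have img: "(\<lambda>i. a ^ i) ` {..<?n} = - {0}"
  proof
    show "- {0} \<subseteq> (\<lambda>i. a ^ i) ` {..<?n}"
    proof
      fix u :: "'p mod_ring" assume "u \<in> - {0}"
      then obtain i where "u = a ^ i" using a(2) by blast
      then have "u = a ^ (i mod ?n)" using amod by metis
      then show "u \<in> (\<lambda>i. a ^ i) ` {..<?n}" using p by auto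
    qed
  qed (use a(1) in auto)
  have "card (- {0 :: 'p mod_ring}) = ?n" by (simp add: Compl_eq_Diff_UNIV card_Diff_subset)
  then have inj: "inj_on (\<lambda>i. a ^ i) {..<?n}"
    using img by (intro eq_card_imp_inj_on) simp_all
  \<comment> \<open>The nonzero elements in the order 1, a, ..., a^(p-2).\<close>
  define cs where "cs = map (\<lambda>i. a ^ i) [0..<?n]"
  have len: "length cs = ?n" by (simp add: cs_def)
  have dist: "distinct cs" unfolding cs_def distinct_map using inj by (simp add: atLeast0LessThan)
  have set: "set cs = - {0}" unfolding cs_def using img by (simp add: atLeast0LessThan)
  have nth: "cs ! i = a ^ i" if "i < ?n" for i using that by (simp add: cs_def)
  have "cycle_of_list cs t = a * t" for t
  proof (cases "t = 0")
    case True
    then show ?thesis using set by (simp add: id_outside_supp)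
  next
    case False
    then obtain i where i: "i < ?n" "t = a ^ i" using img by blast
    \<comment> \<open>The cycle moves each entry to the next one, and the wrap-around is
      multiplication by a as well because a^(p-1) = 1.\<close>
    have "map (cycle_of_list cs) cs = rotate 1 cs"
      using cyclic_rotation[of cs 1] dist by simp
    then have "cycle_of_list cs (cs ! i) = rotate 1 cs ! i"
      using i len by (metis nth_map)
    also have "\<dots> = cs ! ((1 + i) mod ?n)"
      using i len by (subst nth_rotate) (simp_all add: add.commute)
    also have "\<dots> = a ^ (1 + i)" using nth amod[of "1 + i"] i by simp
    finally show ?thesis using nth i by simp
  qed
  then have "(\<lambda>t. a * t) = cycle_of_list cs" by auto
  moreover have "sign (cycle_of_list cs) = - 1"
  proof -
    obtain x xs where cs: "cs = x # xs" using len p by (cases cs) auto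
    then have "Suc (length xs) = ?n" using len by simp
    then have "CARD('p) = Suc (Suc (length xs))" using p by simp
    then have "odd (length xs)" using odd by simp
    then show ?thesis using sign_cycle_of_list[of x xs] dist cs by simp
  qed
  ultimately show ?thesis by simp
qed

lemma op_trace_diag:
  "op_trace U = (\<Sum>t\<in>UNIV. U (axis t 1) $ t)"
  by (simp add: op_trace_def trace_def matrix_def)

section \<open>Unipotent matrices and one-dimensional characters of \<open>SL2\<close>\<close>

definition upper :: "'k::field \<Rightarrow> 'k ^ 2 ^ 2" where
  "upper x = (\<chi> i j. if i = j then 1 else if i = 1 then x else 0)"

definition lower :: "'k::field \<Rightarrow> 'k ^ 2 ^ 2" where
  "lower x = (\<chi> i j. if i = j then 1 else if i = 1 then 0 else x)"

lemma upper_nth [simp]: "upper x $ 1 $ 1 = 1" "upper x $ 1 $ 2 = x" "upper x $ 2 $ 1 = 0" "upper x $ 2 $ 2 = 1"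
  by (simp_all add: upper_def)

lemma lower_nth [simp]: "lower x $ 1 $ 1 = 1" "lower x $ 1 $ 2 = 0" "lower x $ 2 $ 1 = x" "lower x $ 2 $ 2 = 1"
  by (simp_all add: lower_def)

lemma upper_SL2: "upper x \<in> SL2" and lower_SL2: "lower x \<in> SL2"
  by (simp_all add: SL2_def det_2)

lemma upper_add: "upper (x + y) = upper x ** upper y"
  and lower_add: "lower (x + y) = lower x ** lower y"
  by (simp_all add: matrix_eq_iff_2 matrix_mult_nth_2)

text \<open>Moving a unipotent matrix past diag(b, 1/b) scales its parameter by b^2; this is the
  source of the commutators.\<close>

lemma diag2_upper: "b \<noteq> 0 \<Longrightarrow> diag2 b ** upper x = upper (b ^ 2 * x) ** diag2 b"
  and diag2_lower: "b \<noteq> 0 \<Longrightarrow> lower x ** diag2 b = diag2 b ** lower (b ^ 2 * x)"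
  by (simp_all add: matrix_eq_iff_2 matrix_mult_nth_2 power2_eq_square)

text \<open>This is w(a) w(-1) with w(x) = \<open>upper x ** lower (- 1 / x) ** upper x\<close>, the
  antidiagonal matrix with entries x and -1/x.\<close>

lemma diag2_factorization:
  assumes "a \<noteq> 0"
  shows "diag2 a = upper a ** lower (- 1 / a) ** upper a ** upper (- 1) ** lower 1 ** upper (- 1)"
  using assms by (simp add: matrix_eq_iff_2 matrix_mult_nth_2)

text \<open>The unipotent subgroups consist of commutators as soon as some \<open>b\<^sup>2\<close> differs from \<open>0\<close> and \<open>1\<close>.\<close>
lemma SL2_hom_diag2_eq_1:
  fixes D :: "'k::field ^ 2 ^ 2 \<Rightarrow> complex"
  assumes mult: "\<And>g h. g \<in> SL2 \<Longrightarrow> h \<in> SL2 \<Longrightarrow> D (g ** h) = D g * D h"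
    and nz: "\<And>g. g \<in> SL2 \<Longrightarrow> D g \<noteq> 0"
    and b: "b \<noteq> 0" "b ^ 2 \<noteq> (1 :: 'k)" and a: "a \<noteq> 0"
  shows "D (diag2 a) = 1"
proof -
  have db: "diag2 b \<in> SL2" using b by (simp add: SL2_def det_2)
  have "D (upper (b ^ 2 * x)) = D (upper x)" for x
    using mult[OF db upper_SL2[of x]] mult[OF upper_SL2[of "b ^ 2 * x"] db] nz[OF db]
    by (simp add: diag2_upper b)
  \<comment> \<open>A quotient of two unipotents on which \<open>D\<close> agrees.\<close>
  moreover have "upper (b ^ 2 * x) = upper ((b ^ 2 - 1) * x) ** upper x" for x
    by (simp add: left_diff_distrib flip: upper_add)
  ultimately have "D (upper ((b ^ 2 - 1) * x)) = 1" for x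
    using mult[OF upper_SL2[of "(b ^ 2 - 1) * x"] upper_SL2[of x]] nz[OF upper_SL2[of x]] by simp
  \<comment> \<open>As b^2 - 1 is invertible, every parameter is reached.\<close>
  from this[of "x / (b ^ 2 - 1)" for x] have U: "D (upper x) = 1" for x using b by simp
  have "D (lower (b ^ 2 * x)) = D (lower x)" for x
    using mult[OF lower_SL2[of x] db] mult[OF db lower_SL2[of "b ^ 2 * x"]] nz[OF db]
    by (simp add: diag2_lower b)
  moreover have "lower (b ^ 2 * x) = lower ((b ^ 2 - 1) * x) ** lower x" for x
    by (simp add: left_diff_distrib flip: lower_add)
  ultimately have "D (lower ((b ^ 2 - 1) * x)) = 1" for x
    using mult[OF lower_SL2[of "(b ^ 2 - 1) * x"] lower_SL2[of x]] nz[OF lower_SL2[of x]] by simp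
  from this[of "x / (b ^ 2 - 1)" for x] have L: "D (lower x) = 1" for x using b by simp
  show ?thesis
    unfolding diag2_factorization[OF a] by (simp add: mult U L upper_SL2 lower_SL2 SL2_mult)
qed

text \<open>Otherwise the field would lie inside {0, 1, -1}.\<close>

lemma exists_square_neq_1:
  assumes "CARD('p::prime_card) > 3"
  shows "\<exists>b :: 'p mod_ring. b \<noteq> 0 \<and> b ^ 2 \<noteq> 1"
proof (rule ccontr)
  assume "\<not> ?thesis"
  then have "(UNIV :: 'p mod_ring set) \<subseteq> {0, 1, - 1}" by (auto simp: power2_eq_1_iff)
  then have "card (UNIV :: 'p mod_ring set) \<le> card {0, 1, - 1 :: 'p mod_ring}" by (intro card_mono) auto
  also have "\<dots> \<le> 3" by (simp add: card_insert_if)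
  finally show False using assms by simp
qed

section \<open>The determinant of the Weil representation\<close>

context weil
begin

definition det_rho :: "'p mod_ring ^ 2 ^ 2 \<Rightarrow> complex" where
  "det_rho g = det (matrix (\<rho> g))"

lemma det_rho_mult: "g \<in> SL2 \<Longrightarrow> h \<in> SL2 \<Longrightarrow> det_rho (g ** h) = det_rho g * det_rho h"
proof -
  assume gh: "g \<in> SL2" "h \<in> SL2"
  then have "\<rho> (g ** h) = \<rho> g \<circ> \<rho> h" by (auto simp: rho_mult)
  then show ?thesis
    using matrix_compose_gen[OF linear(5)[OF gh(2)] linear(5)[OF gh(1)]] by (simp add: det_rho_def det_mul)
qed

lemma det_rho_1: "det_rho (mat 1) = 1"
proof -
  have "\<rho> (mat 1) = id" by (auto simp: rho_one)
  then show ?thesis by (simp add: det_rho_def matrix_id_mat_1)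
qed

lemma det_rho_neq_0:
  assumes "g \<in> SL2"
  shows "det_rho g \<noteq> 0"
  using det_rho_mult[OF assms SL2_inverse[OF assms]] det_rho_1 matrix_inv_right[OF SL2_invertible[OF assms]]
  by auto

text \<open>The matrix of the operator is c(a) times the permutation matrix of t -> t / a.\<close>

lemma det_rho_diag2:
  assumes a: "a \<noteq> 0"
  shows "det_rho (diag2 a) = torus_char a ^ CARD('p) * of_int (sign (\<lambda>t. t / a))"
proof -
  let ?\<pi> = "\<lambda>t. t / a"
  have perm: "?\<pi> permutes UNIV"
    using a by (intro bij_imp_permutes bij_betw_byWitness[where f'="\<lambda>t. t * a"]) auto
  have "matrix (\<rho> (diag2 a)) = (\<chi> i. torus_char a *s (\<chi> i. (mat 1 :: complex ^ 'p mod_ring ^ 'p mod_ring) $ ?\<pi> i) $ i)"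
    by (auto simp: vec_eq_iff matrix_def rho_diag2_eq[OF a] axis_def mat_def)
  then have "det_rho (diag2 a) = det (\<chi> i. torus_char a *s (\<chi> i. (mat 1 :: complex ^ 'p mod_ring ^ 'p mod_ring) $ ?\<pi> i) $ i)"
    by (simp only: det_rho_def)
  also have "\<dots> = (\<Prod>i\<in>(UNIV :: 'p mod_ring set). torus_char a) *
      det (\<chi> i. (\<chi> i. (mat 1 :: complex ^ 'p mod_ring ^ 'p mod_ring) $ ?\<pi> i) $ i)"
    by (rule det_rows_mul)
  also have "\<dots> = torus_char a ^ CARD('p) * of_int (sign ?\<pi>)"
    using det_permute_rows[OF perm, of "mat 1 :: complex ^ 'p mod_ring ^ 'p mod_ring"] by simp
  finally show ?thesis .
qed

text \<open>The trace formula is evaluated at g = -I and v = 0. The Cayley transform vanishes,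
  leaving the quadratic character at -1, while t -> -t fixes only 0 and so the trace is
  c(-1).\<close>

lemma torus_char_minus_1_card_3:
  assumes p3: "CARD('p) = 3"
  shows "torus_char (- 1) = - 1"
proof -
  have odd: "odd CARD('p)" using p3 by simp
  have two: "(2 :: 'p mod_ring) \<noteq> 0" by (rule mod_ring_two_neq_0[OF odd])
  let ?g = "diag2 (- 1) :: 'p mod_ring ^ 2 ^ 2"
  have g: "?g \<in> SL2" by (rule diag2_SL2) simp
  have inv: "invertible (?g - mat 1)"
  proof -
    have "det (?g - mat 1) = 2 * 2" by (simp add: det_2 mat_def)
    then show ?thesis using two by (metis invertible_det_nz mult_eq_0_iff)
  qed
  have "?g + mat 1 = 0" by (simp add: matrix_eq_iff_2 mat_def)
  then have cay: "cayley ?g = 0" by (simp add: cayley_def)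
  have "op_trace (\<rho> ?g \<circ> heis_rep (- (0 :: 'p mod_ring ^ 2) $ 1, - (0 :: 'p mod_ring ^ 2) $ 2, 0)) =
      quadratic_character (- det (cayley ?g + mat 1)) * psi (1 / 4 * symp (cayley ?g *v 0) 0)"
    using weil g inv p3 unfolding weil_representation_def by blast
  moreover have "heis_rep (- (0 :: 'p mod_ring ^ 2) $ 1, - (0 :: 'p mod_ring ^ 2) $ 2, 0) = id"
    by (auto simp: vec_eq_iff heis_rep_translation simp del: heis_rep.simps)
  ultimately have tr: "op_trace (\<rho> ?g) = quadratic_character (- 1 :: 'p mod_ring)"
    by (simp add: cay symp_def)
  have "t / (- 1) = t \<longleftrightarrow> t = 0" for t :: "'p mod_ring"
  proof -
    have "t / (- 1) = t \<longleftrightarrow> 2 * t = 0"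
      by (simp only: divide_minus1 neg_eq_iff_add_eq_0 mult_2)
    then show ?thesis using two by simp
  qed
  then have "\<rho> ?g (axis t 1) $ t = (if t = 0 then torus_char (- 1) else 0)" for t
    using rho_diag2_eq[of "- 1" "axis t 1" t] by (auto simp: axis_def simp del: divide_minus1)
  then have "op_trace (\<rho> ?g) = torus_char (- 1)"
    by (simp add: op_trace_diag)
  moreover have "quadratic_character (- 1 :: 'p mod_ring) = - 1"
  proof -
    have "to_int_mod_ring (- 1 :: 'p mod_ring) = 2" using p3 by transfer simp
    moreover have "\<not> QuadRes 3 2"
    proof
      assume "QuadRes 3 2"
      then obtain y :: int where "[y ^ 2 = 2] (mod 3)" unfolding QuadRes_def by blast
      then have "y ^ 2 mod 3 = 2" by (simp add: cong_def)
      then have "(y mod 3) ^ 2 mod 3 = 2" by (simp add: power_mod)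
      moreover have "y mod 3 = 0 \<or> y mod 3 = 1 \<or> y mod 3 = 2" by presburger
      ultimately show False by auto
    qed
    ultimately show ?thesis using p3 by (simp add: quadratic_character_def Legendre_def cong_def)
  qed
  ultimately show ?thesis using tr by simp
qed

text \<open>For p > 3 the trivial determinant gives c(a)^p = sign of t -> t / a, and c(a)^p = c(a)
  by Fermat. For p = 3 every nonzero square is 1, and c(-1) = -1 is the nontrivial value.\<close>

lemma torus_char_order_two:
  assumes odd: "odd CARD('p)"
  shows "\<exists>a. a \<noteq> 0 \<and> torus_char a \<noteq> 1" and "a \<noteq> 0 \<Longrightarrow> torus_char a ^ 2 = 1"
proof -
  have p: "CARD('p) > 1" using prime_card[where 'a='p] prime_gt_1_nat by blast
  then have "CARD('p) \<ge> 2" by simp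
  moreover have "CARD('p) \<noteq> 2" using odd by auto
  ultimately consider "CARD('p) = 3" | "CARD('p) > 3" by linarith
  then have "(\<exists>a. a \<noteq> 0 \<and> torus_char a \<noteq> 1) \<and> (\<forall>a. a \<noteq> 0 \<longrightarrow> torus_char a ^ 2 = 1)"
  proof cases
    case 1
    have "torus_char a ^ 2 = 1" if a: "a \<noteq> 0" for a
    proof -
      have "a * a ^ 2 = a * 1" using mod_ring_power_card[of a] 1 by (simp add: power3_eq_cube power2_eq_square)
      then have "a ^ 2 = 1" using a by simp
      then show ?thesis using torus_char_power[OF a, of 2] torus_char_1 by simp
    qed
    moreover have "torus_char (- 1) \<noteq> 1" using torus_char_minus_1_card_3[OF 1] by simp
    moreover have "(- 1 :: 'p mod_ring) \<noteq> 0" by simp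
    ultimately show ?thesis by blast
  next
    case 2
    obtain b :: "'p mod_ring" where b: "b \<noteq> 0" "b ^ 2 \<noteq> 1" using exists_square_neq_1[OF 2] by blast
    have det1: "torus_char a ^ CARD('p) * of_int (sign (\<lambda>t. t / a)) = 1" if "a \<noteq> 0" for a
      using SL2_hom_diag2_eq_1[of det_rho, OF det_rho_mult det_rho_neq_0 b that] det_rho_diag2[OF that] by simp
    obtain a :: "'p mod_ring" where a: "a \<noteq> 0" "\<And>u. u \<noteq> 0 \<Longrightarrow> \<exists>i. u = a ^ i"
      using generator_mod_ring by blast
    have sq: "torus_char u ^ 2 = 1" if u: "u \<noteq> 0" for u
    proof -
      let ?c = "torus_char u"
      have "u * u ^ (CARD('p) - 1) = u * 1"
        using mod_ring_power_card[of u] p by (simp flip: power_Suc)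
      then have "u ^ (CARD('p) - 1) = 1" using u by simp
      then have "?c ^ (CARD('p) - 1) = 1" using torus_char_power[OF u] torus_char_1 by metis
      then have "?c ^ CARD('p) = ?c" using p by (simp add: power_eq_if)
      then have "?c * of_int (sign (\<lambda>t. t / u)) = 1" using det1[OF u] by simp
      moreover have "(of_int (sign (\<lambda>t. t / u)) :: complex) ^ 2 = 1"
        by (cases "\<lambda>t. t / u" rule: sign_cases) simp_all
      ultimately show ?thesis by (metis mult.right_neutral power_mult_distrib power_one)
    qed
    \<comment> \<open>Dividing by 1/a is multiplication by the generator, whose sign is
      known.\<close>
    have "torus_char (1 / a) ^ CARD('p) * of_int (sign (\<lambda>t. a * t)) = 1"
      using det1[of "1 / a"] a(1) by (simp add: mult.commute)
    then have "torus_char (1 / a) \<noteq> 1" using sign_mult_generator[OF odd a] by auto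
    then show ?thesis using sq a(1) by (metis divide_eq_0_iff zero_neq_one)
  qed
  then show "\<exists>a. a \<noteq> 0 \<and> torus_char a \<noteq> 1" and "a \<noteq> 0 \<Longrightarrow> torus_char a ^ 2 = 1" by blast+
qed

end

section \<open>Conjugating characters and eigenvectors\<close>

text \<open>Conjugation is a group isomorphism, so it preserves orders of characters;
  \<open>restrict\<close> keeps the transported character extensional.\<close>

lemma nonquadratic_dual_conj:
  assumes h: "invertible h" and T: "SL2_subgroup T" and \<theta>: "\<theta> \<in> nonquadratic_dual T"
  shows "restrict (\<lambda>N. \<theta> (matrix_inv h ** N ** h)) (conj_set h T) \<in> nonquadratic_dual (conj_set h T)"
    (is "?\<theta> \<in> _")
proof -
  note iff = in_conj_set_iff[OF h]
  have \<theta>_nz: "\<theta> g \<noteq> 0" if "g \<in> T" for g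
    using \<theta> that by (auto simp: nonquadratic_dual_def torus_dual_def)
  have \<theta>_mult: "\<theta> (g ** g') = \<theta> g * \<theta> g'" if "g \<in> T" "g' \<in> T" for g g'
    using \<theta> that by (auto simp: nonquadratic_dual_def torus_dual_def)
  have mult: "matrix_inv h ** (N ** N') ** h = (matrix_inv h ** N ** h) ** (matrix_inv h ** N' ** h)" for N N'
    using conj_mult[OF matrix_inv_matrix_inv(2)[OF h], of N N'] by (simp add: matrix_inv_matrix_inv[OF h])
  have closed: "N ** N' \<in> conj_set h T" if "N \<in> conj_set h T" "N' \<in> conj_set h T" for N N'
    using SL2_subgroup_conj[OF h T] that unfolding SL2_subgroup_def by blast
  have in_conj: "h ** g ** matrix_inv h \<in> conj_set h T" if "g \<in> T" for g
    using that unfolding conj_set_def by blast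
  then have val: "?\<theta> (h ** g ** matrix_inv h) = \<theta> g" if "g \<in> T" for g
    using that conj_cancel(1)[OF h] by simp
  have "?\<theta> \<in> conj_set h T \<rightarrow>\<^sub>E - {0}"
    using \<theta>_nz iff by auto
  moreover have "?\<theta> (N ** N') = ?\<theta> N * ?\<theta> N'" if "N \<in> conj_set h T" "N' \<in> conj_set h T" for N N'
    using that closed[OF that] iff \<theta>_mult by (simp add: mult)
  moreover have "\<not> has_order_two (conj_set h T) ?\<theta>"
  proof
    assume two: "has_order_two (conj_set h T) ?\<theta>"
    then obtain N where N: "N \<in> conj_set h T" "?\<theta> N \<noteq> 1" unfolding has_order_two_def by blast
    have "\<theta> g ^ 2 = 1" if "g \<in> T" for g
      using two in_conj[OF that] val[OF that] unfolding has_order_two_def by metis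
    moreover have "matrix_inv h ** N ** h \<in> T" "\<theta> (matrix_inv h ** N ** h) \<noteq> 1"
      using N iff by simp_all
    ultimately have "has_order_two T \<theta>" unfolding has_order_two_def by blast
    then show False using \<theta> by (simp add: nonquadratic_dual_def)
  qed
  ultimately show ?thesis unfolding nonquadratic_dual_def torus_dual_def by blast
qed

context weil
begin

text \<open>N h = h M with M = h^-1 N h in \<open>T\<close>, so \<open>N\<close> acts on
  \<open>\<rho> h \<phi>\<close> as \<open>M\<close> acts on \<phi>.\<close>

lemma eigenspace_conj:
  assumes h: "h \<in> SL2" and T: "SL2_subgroup T" and \<phi>: "\<phi> \<in> eigenspace \<rho> T \<theta>"
  shows "\<rho> h \<phi> \<in> eigenspace \<rho> (conj_set h T) (restrict (\<lambda>N. \<theta> (matrix_inv h ** N ** h)) (conj_set h T))"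
proof -
  note hi = SL2_invertible[OF h]
  have "\<rho> N (\<rho> h \<phi>) = \<theta> (matrix_inv h ** N ** h) *s \<rho> h \<phi>" if N: "N \<in> conj_set h T" for N
  proof -
    let ?M = "matrix_inv h ** N ** h"
    have M: "?M \<in> T" using N in_conj_set_iff[OF hi] by blast
    then have SL: "?M \<in> SL2" "N \<in> SL2"
      using T SL2_subgroup_conj[OF hi T] N unfolding SL2_subgroup_def by blast+
    have "N ** h = h ** ?M"
      using matrix_inv_right[OF hi] by (simp add: matrix_mul_assoc)
    then have "\<rho> N (\<rho> h \<phi>) = \<rho> h (\<rho> ?M \<phi>)"
      using rho_mult[OF SL(2) h] rho_mult[OF h SL(1)] by metis
    also have "\<rho> ?M \<phi> = \<theta> ?M *s \<phi>" using \<phi> M by (simp add: eigenspace_def)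
    finally show ?thesis by (simp only: linear[OF h])
  qed
  then show ?thesis by (simp add: eigenspace_def)
qed

text \<open>This bounds the eigenspace dimensions by one and does not assert that eigenvectors
  exist.\<close>

definition multiplicity_one :: "('p mod_ring ^ 2 ^ 2) set \<Rightarrow> bool" where
  "multiplicity_one T \<longleftrightarrow> (\<forall>\<theta>\<in>nonquadratic_dual T. \<forall>\<phi>\<in>eigenspace \<rho> T \<theta>. \<forall>\<phi>'\<in>eigenspace \<rho> T \<theta>.
     \<phi> \<noteq> 0 \<longrightarrow> (\<exists>k. \<phi>' = k *s \<phi>))"

text \<open>Both eigenvectors are carried back to \<open>T\<close> by the inverse of
  \<open>h\<close>, compared there, and returned.\<close>

lemma multiplicity_one_conj:
  assumes h: "h \<in> SL2" and T: "SL2_subgroup (conj_set h T)" and one: "multiplicity_one T"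
  shows "multiplicity_one (conj_set h T)"
  unfolding multiplicity_one_def
proof (intro ballI impI)
  fix \<theta> :: "'p mod_ring ^ 2 ^ 2 \<Rightarrow> complex" and \<phi> \<phi>'
  note hi = SL2_invertible[OF h]
  let ?k = "matrix_inv h"
  let ?\<theta> = "restrict (\<lambda>N. \<theta> (matrix_inv ?k ** N ** ?k)) (conj_set ?k (conj_set h T))"
  assume \<theta>: "\<theta> \<in> nonquadratic_dual (conj_set h T)"
    and \<phi>: "\<phi> \<in> eigenspace \<rho> (conj_set h T) \<theta>" "\<phi>' \<in> eigenspace \<rho> (conj_set h T) \<theta>" "\<phi> \<noteq> 0"
  have k: "?k \<in> SL2" by (rule SL2_inverse[OF h])
  have T': "conj_set ?k (conj_set h T) = T" by (rule conj_set_conj_set_inv[OF hi])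
  have "?\<theta> \<in> nonquadratic_dual T"
    using nonquadratic_dual_conj[OF SL2_invertible[OF k] T \<theta>] unfolding T' .
  moreover have "\<rho> ?k \<phi> \<in> eigenspace \<rho> T ?\<theta>" "\<rho> ?k \<phi>' \<in> eigenspace \<rho> T ?\<theta>"
    using eigenspace_conj[OF k T \<phi>(1)] eigenspace_conj[OF k T \<phi>(2)] unfolding T' .
  moreover have "\<rho> ?k \<phi> \<noteq> 0" using \<phi>(3) rho_inverse(2)[OF h] linear(4)[OF h] by metis
  ultimately obtain c where "\<rho> ?k \<phi>' = c *s \<rho> ?k \<phi>" using one unfolding multiplicity_one_def by blast
  then have "\<rho> h (\<rho> ?k \<phi>') = c *s \<rho> h (\<rho> ?k \<phi>)" by (simp only: linear[OF h])
  then show "\<exists>c. \<phi>' = c *s \<phi>" by (simp only: rho_inverse[OF h]) blast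
qed

text \<open>The diagonal torus acts by the permutations \<open>t \<mapsto> t / a\<close> twisted by the quadratic character, so
  an eigenvector for another character vanishes at \<open>0\<close> and is determined by its value at \<open>1\<close>.\<close>
lemma multiplicity_one_diag_torus:
  assumes odd: "odd CARD('p)"
  shows "multiplicity_one diag_torus"
  unfolding multiplicity_one_def
proof (intro ballI impI)
  fix \<theta> \<phi> \<phi>'
  assume \<theta>: "\<theta> \<in> nonquadratic_dual diag_torus"
    and \<phi>: "\<phi> \<in> eigenspace \<rho> diag_torus \<theta>" "\<phi>' \<in> eigenspace \<rho> diag_torus \<theta>" "\<phi> \<noteq> 0"
  have in_diag: "diag2 a \<in> diag_torus" if "a \<noteq> 0" for a :: "'p mod_ring"
    using that unfolding diag_torus_def by blast
  have nz: "\<theta> (diag2 a) \<noteq> 0" if "a \<noteq> 0" for a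
    using \<theta> in_diag[OF that] by (auto simp: nonquadratic_dual_def torus_dual_def)
  have eig: "torus_char a * f $ (t / a) = \<theta> (diag2 a) * f $ t"
    if "f \<in> eigenspace \<rho> diag_torus \<theta>" "a \<noteq> 0" for f a t
    using that in_diag[of a] rho_diag2_eq[of a f t] by (simp add: eigenspace_def)
  \<comment> \<open>If \<theta> agreed with \<open>torus_char\<close> on the whole torus, it would
    have order two.\<close>
  have "\<exists>a. a \<noteq> 0 \<and> \<theta> (diag2 a) \<noteq> torus_char a"
  proof (rule ccontr)
    assume "\<not> ?thesis"
    then have eq: "\<theta> (diag2 a) = torus_char a" if "a \<noteq> 0" for a using that by blast
    obtain b where b: "b \<noteq> 0" "torus_char b \<noteq> 1" using torus_char_order_two(1)[OF odd] by blast
    have "\<exists>g\<in>diag_torus. \<theta> g \<noteq> 1"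
      by (rule bexI[OF _ in_diag[OF b(1)]]) (simp add: eq[OF b(1)] b(2))
    moreover have "\<forall>g\<in>diag_torus. \<theta> g ^ 2 = 1"
      unfolding diag_torus_def using torus_char_order_two(2)[OF odd] eq by auto
    ultimately show False using \<theta> by (simp add: nonquadratic_dual_def has_order_two_def)
  qed
  then obtain a where a: "a \<noteq> 0" "\<theta> (diag2 a) \<noteq> torus_char a" by blast
  \<comment> \<open>At t = 0 the eigenvector equation compares two different multiples of
    \<open>f $ 0\<close>.\<close>
  have zero: "f $ 0 = 0" if "f \<in> eigenspace \<rho> diag_torus \<theta>" for f
    using eig[OF that a(1), of 0] a(2) by simp
  \<comment> \<open>The eigenvector equation with a = t links the values at t and at 1.\<close>
  have one: "f $ t = torus_char t / \<theta> (diag2 t) * f $ 1" if "f \<in> eigenspace \<rho> diag_torus \<theta>" "t \<noteq> 0" for f t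
    using eig[OF that, of t] nz[OF that(2)] that(2) by (simp add: field_simps)
  have "\<phi> $ 1 \<noteq> 0"
  proof
    assume "\<phi> $ 1 = 0"
    then have "\<phi> $ t = 0" for t using zero[OF \<phi>(1)] one[OF \<phi>(1), of t] by (cases "t = 0") auto
    then show False using \<phi>(3) by (simp add: vec_eq_iff)
  qed
  then have key: "\<phi>' $ t = (\<phi>' $ 1 / \<phi> $ 1) * \<phi> $ t" for t
  proof (cases "t = 0")
    case True
    show ?thesis unfolding True zero[OF \<phi>(1)] zero[OF \<phi>(2)] by simp
  next
    case False
    define q where "q = torus_char t / \<theta> (diag2 t)"
    have "\<phi> $ t = q * \<phi> $ 1" "\<phi>' $ t = q * \<phi>' $ 1"
      unfolding q_def by (rule one[OF \<phi>(1) False], rule one[OF \<phi>(2) False])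
    then have "\<phi>' $ t * \<phi> $ 1 = \<phi>' $ 1 * \<phi> $ t" by simp
    then show ?thesis using \<open>\<phi> $ 1 \<noteq> 0\<close> by (simp add: eq_divide_imp)
  qed
  have "\<phi>' = (\<phi>' $ 1 / \<phi> $ 1) *s \<phi>"
    unfolding vec_eq_iff vector_smult_component using key by blast
  then show "\<exists>k. \<phi>' = k *s \<phi>" ..
qed

end

section \<open>Unitary operators with simple spectrum\<close>

lemma cinner_commute: "cinner v u = cnj (cinner u v)"
  by (simp add: cinner_def mult.commute)

text \<open>Nonzero pairwise orthogonal vectors are linearly independent.\<close>

lemma card_orthogonal_le:
  fixes B :: "'p::prime_card hilb set"
  assumes fin: "finite B" and nz: "0 \<notin> B" and orth: "\<And>u v. u \<in> B \<Longrightarrow> v \<in> B \<Longrightarrow> u \<noteq> v \<Longrightarrow> cinner u v = 0"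
  shows "card B \<le> CARD('p)"
proof -
  have "vec.independent B"
    unfolding vec.independent_explicit
  proof (intro conjI fin allI impI ballI)
    fix c v
    assume sum: "(\<Sum>v\<in>B. c v *s v) = 0" and v: "v \<in> B"
    have "0 = cinner (\<Sum>u\<in>B. c u *s u) v" by (simp add: sum cinner_def)
    also have "\<dots> = (\<Sum>u\<in>B. if u = v then c v * cinner v v else 0)"
      unfolding cinner_sum_left using orth v by (intro sum.cong) (auto simp: cinner_scale_left)
    finally have "c v * cinner v v = 0" using fin v by simp
    then show "c v = 0" using nz v cinner_self_eq_0_iff[of v] by auto
  qed
  then have "card B \<le> vec.dim B" using vec.independent_bound_general by blast
  also have "\<dots> \<le> vec.dim (UNIV :: 'p hilb set)" by (rule vec.dim_subset) simp
  also have "\<dots> = CARD('p)" by (simp only: vec_dim_card CARD_mod_ring)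
  finally show ?thesis .
qed

text \<open>If v is nonzero, \<beta> has modulus one; then <u,v> = \<alpha> cnj(\<beta>) <u,v> with
  a factor different from 1.\<close>

lemma unitary_eigenvectors_orthogonal:
  assumes U: "unitary_op U" and u: "U u = \<alpha> *s u" and v: "U v = \<beta> *s v" and ne: "\<alpha> \<noteq> \<beta>"
  shows "cinner u v = 0"
proof (cases "v = 0")
  case False
  have inner: "cinner (U x) (U y) = cinner x y" for x y using U by (simp add: unitary_op_def)
  have "cinner v v \<noteq> 0" using False by (simp add: cinner_self_eq_0_iff)
  then have \<beta>: "\<beta> * cnj \<beta> = 1" using inner[of v v] by (simp add: v cinner_scale_left cinner_scale_right mult.commute)
  have "\<alpha> * cnj \<beta> * cinner u v = cinner u v"
    using inner[of u v] by (simp add: u v cinner_scale_left cinner_scale_right mult.commute)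
  moreover have "\<alpha> * cnj \<beta> \<noteq> 1"
    using \<beta> ne by (metis mult.assoc mult.commute mult.right_neutral)
  ultimately show ?thesis by auto
qed (simp add: cinner_def)

text \<open>A second independent eigenvector for \<open>l\<close>, together with eigenvectors for
  the other p - 1 values, would yield p + 1 nonzero orthogonal vectors.\<close>

lemma eigenvalue_simple:
  fixes U :: "'p::prime_card hilb \<Rightarrow> 'p hilb"
  assumes U: "unitary_op U" and Z: "card Z = CARD('p)"
    and ev: "\<And>z. z \<in> Z \<Longrightarrow> v z \<noteq> 0 \<and> U (v z) = z *s v z"
    and l: "l \<in> Z" "U \<phi> = l *s \<phi>" "U \<phi>' = l *s \<phi>'" "\<phi> \<noteq> 0"
  shows "\<exists>k. \<phi>' = k *s \<phi>"
proof (rule ccontr)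
  assume contra: "\<nexists>k. \<phi>' = k *s \<phi>"
  define k where "k = cinner \<phi>' \<phi> / cinner \<phi> \<phi>"
  \<comment> \<open>Gram-Schmidt: the part of \<open>\<phi>'\<close> orthogonal to \<phi>, again an
    eigenvector for \<open>l\<close>.\<close>
  define \<eta> where "\<eta> = \<phi>' + (- k) *s \<phi>"
  have "cinner \<phi> \<phi> \<noteq> 0" using l(4) by (simp add: cinner_self_eq_0_iff)
  then have orth: "cinner \<eta> \<phi> = 0" unfolding \<eta>_def cinner_add_left cinner_scale_left k_def by simp
  have "\<eta> \<noteq> 0"
  proof
    assume "\<eta> = 0"
    then have "\<phi>' = k *s \<phi>" by (simp add: \<eta>_def vec_eq_iff)
    then show False using contra by blast
  qed
  have "U \<eta> = l *s \<eta>"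
    unfolding \<eta>_def unitary_op_linear[OF U] l by (simp add: vec_eq_iff algebra_simps)
  have finZ: "finite Z" using Z by (metis card.infinite zero_less_card_finite less_irrefl)
  let ?B = "insert \<phi> (insert \<eta> (v ` (Z - {l})))"
  have vz: "cinner (v z) u = 0" "cinner u (v z) = 0" if "z \<in> Z - {l}" "U u = l *s u" for z u
    using unitary_eigenvectors_orthogonal[OF U] ev[of z] that by blast+
  have vv: "cinner (v z) (v z') = 0" if "z \<in> Z" "z' \<in> Z" "v z \<noteq> v z'" for z z'
    using unitary_eigenvectors_orthogonal[OF U] ev that by blast
  have self: "cinner u u \<noteq> 0" if "u \<in> ?B" for u
    using that l(4) \<open>\<eta> \<noteq> 0\<close> ev by (auto simp: cinner_self_eq_0_iff)
  have orth': "cinner \<phi> \<eta> = 0" using orth cinner_commute[of \<eta> \<phi>] by simp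
  have "cinner u w = 0" if "u \<in> ?B" "w \<in> ?B" "u \<noteq> w" for u w
    using that orth orth' vz[OF _ l(2)] vz[OF _ \<open>U \<eta> = l *s \<eta>\<close>] vv by auto
  moreover have "0 \<notin> ?B" using self[of 0] cinner_self_eq_0_iff[of 0] by blast
  ultimately have "card ?B \<le> CARD('p)" using finZ by (intro card_orthogonal_le) auto
  moreover have "card ?B = Suc (CARD('p))"
  proof -
    have "inj_on v (Z - {l})"
    proof (rule inj_onI)
      fix z z' assume z: "z \<in> Z - {l}" "z' \<in> Z - {l}" "v z = v z'"
      have "cinner (v z) (v z') = 0" if "z \<noteq> z'"
        using unitary_eigenvectors_orthogonal[OF U] ev[of z] ev[of z'] z that by blast
      then show "z = z'" using ev[of z] z cinner_self_eq_0_iff[of "v z"] by auto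
    qed
    then have "card (v ` (Z - {l})) = CARD('p) - 1"
      using Z l(1) finZ by (simp add: card_image)
    moreover have "\<eta> \<notin> v ` (Z - {l})"
      using vz(1)[OF _ \<open>U \<eta> = l *s \<eta>\<close>] \<open>\<eta> \<noteq> 0\<close> cinner_self_eq_0_iff[of \<eta>] by auto
    moreover have "\<phi> \<notin> v ` (Z - {l})"
      using vz(1)[OF _ l(2)] l(4) cinner_self_eq_0_iff[of \<phi>] by auto
    moreover have "\<phi> \<noteq> \<eta>" using orth l(4) cinner_self_eq_0_iff[of \<phi>] by auto
    ultimately show ?thesis using finZ by simp
  qed
  ultimately show False by simp
qed

section \<open>Non-split tori\<close>

text \<open>The ring structure of \<open>F[\<surd>d]\<close> on pairs \<open>(x, y)\<close> standing for \<open>x + y \<surd>d\<close>.\<close>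
definition quad_ext :: "'k::field \<Rightarrow> ('k \<times> 'k) ring" where
  "quad_ext d = \<lparr>carrier = UNIV,
     monoid.mult = (\<lambda>u v. (fst u * fst v + d * (snd u * snd v), fst u * snd v + snd u * fst v)),
     one = (1, 0), ring.zero = (0, 0), add = (\<lambda>u v. (fst u + fst v, snd u + snd v))\<rparr>"

definition quad_norm :: "'k::field \<Rightarrow> 'k \<times> 'k \<Rightarrow> 'k" where
  "quad_norm d u = fst u ^ 2 - d * snd u ^ 2"

lemma quad_norm_eq_0_iff:
  assumes "\<nexists>s. s ^ 2 = d"
  shows "quad_norm d u = 0 \<longleftrightarrow> u = (0, 0)"
proof
  assume eq: "quad_norm d u = 0"
  have "snd u = 0"
  proof (rule ccontr)
    assume "snd u \<noteq> 0"
    then have "(fst u / snd u) ^ 2 = d" using eq by (simp add: quad_norm_def power_divide)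
    then show False using assms by blast
  qed
  then show "u = (0, 0)" using eq by (simp add: quad_norm_def prod_eq_iff)
qed (simp add: quad_norm_def)

text \<open>The inverse is the conjugate divided by the norm, which is nonzero because d is not a
  square.\<close>

lemma field_quad_ext:
  fixes d :: "'k::field"
  assumes d: "\<nexists>s. s ^ 2 = d"
  shows "field (quad_ext d)"
proof (rule cring.cring_fieldI2)
  show "cring (quad_ext d)"
  proof (rule cringI)
    show "abelian_group (quad_ext d)"
    proof (rule abelian_groupI)
      fix x assume "x \<in> carrier (quad_ext d)"
      show "\<exists>y\<in>carrier (quad_ext d). y \<oplus>\<^bsub>quad_ext d\<^esub> x = \<zero>\<^bsub>quad_ext d\<^esub>"
        by (rule bexI[of _ "(- fst x, - snd x)"]) (simp_all add: quad_ext_def)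
    qed (simp_all add: quad_ext_def)
    show "comm_monoid (quad_ext d)"
      by (rule comm_monoidI) (simp_all add: quad_ext_def algebra_simps)
  qed (simp_all add: quad_ext_def algebra_simps)
  show "\<zero>\<^bsub>quad_ext d\<^esub> \<noteq> \<one>\<^bsub>quad_ext d\<^esub>" by (simp add: quad_ext_def)
  fix u assume "u \<in> carrier (quad_ext d)" "u \<noteq> \<zero>\<^bsub>quad_ext d\<^esub>"
  then have N: "quad_norm d u \<noteq> 0" using quad_norm_eq_0_iff[OF d] by (simp add: quad_ext_def)
  have "fst u * fst u - d * (snd u * snd u) = quad_norm d u"
    by (simp add: quad_norm_def power2_eq_square)
  then have "u \<otimes>\<^bsub>quad_ext d\<^esub> (fst u / quad_norm d u, - snd u / quad_norm d u) = \<one>\<^bsub>quad_ext d\<^esub>"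
    using N by(simp add: quad_ext_def prod_eq_iff) (simp add: field_simps)
  moreover have "(fst u / quad_norm d u, - snd u / quad_norm d u) \<in> carrier (quad_ext d)"
    by (simp add: quad_ext_def)
  ultimately show "\<exists>b\<in>carrier (quad_ext d). u \<otimes>\<^bsub>quad_ext d\<^esub> b = \<one>\<^bsub>quad_ext d\<^esub>" by blast
qed

lemma quad_norm_mult:
  "quad_norm d (u \<otimes>\<^bsub>quad_ext d\<^esub> v) = quad_norm d u * quad_norm d v"
  by (simp add: quad_norm_def quad_ext_def power2_eq_square algebra_simps)

context
  fixes E :: "'p::prime_card mod_ring ^ 2 ^ 2" and d :: "'p mod_ring"
  assumes trE: "E $ 2 $ 2 = - E $ 1 $ 1" and detE: "det E = - d" and nonsq: "\<nexists>s. s ^ 2 = d"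
begin

lemma d_eq: "d = E $ 1 $ 1 * E $ 1 $ 1 + E $ 1 $ 2 * E $ 2 $ 1"
proof -
  have "d = - det E" using detE by simp
  then show ?thesis by (simp add: det_2 trE)
qed

text \<open>Otherwise d would be the square of the upper left entry.\<close>

lemma E_not_scalar: "E $ 1 $ 2 \<noteq> 0"
proof
  assume "E $ 1 $ 2 = 0"
  then have "E $ 1 $ 1 ^ 2 = d" using d_eq by (simp add: power2_eq_square)
  then show False using nonsq by blast
qed

text \<open>By Cayley-Hamilton E^2 = d, so (x, y) -> x + y E is multiplicative on the quadratic
  extension.\<close>

lemma plane_mult:
  "plane E (fst u) (snd u) ** plane E (fst v) (snd v)
     = plane E (fst (u \<otimes>\<^bsub>quad_ext d\<^esub> v)) (snd (u \<otimes>\<^bsub>quad_ext d\<^esub> v))"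
  by (simp add: matrix_eq_iff_2 matrix_mult_nth_2 quad_ext_def trE d_eq algebra_simps)

lemma det_plane: "det (plane E (fst u) (snd u)) = quad_norm d u"
  by (simp add: det_2 quad_norm_def trE d_eq algebra_simps power2_eq_square)

lemma plane_inj: "plane E (fst u) (snd u) = plane E (fst v) (snd v) \<longleftrightarrow> u = v"
  using E_not_scalar by (auto simp: matrix_eq_iff_2 prod_eq_iff)

text \<open>Lines through the point \<open>(1, 0)\<close> parametrize the conic \<open>x\<^sup>2 - d y\<^sup>2 = 1\<close>.\<close>
lemma card_norm_one_le: "card {u. quad_norm d u = 1} \<le> Suc (CARD('p))"
proof -
  \<comment> \<open>The slope of the line through (1, 0); \<open>None\<close> stands for (1, 0)
    itself, the only point of the conic with x = 1.\<close>
  define f where "f u = (if fst u = 1 then None else Some (snd u / (fst u - 1)))" for u :: "'p mod_ring \<times> 'p mod_ring"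
  have d0: "d \<noteq> 0" using nonsq by (metis power_zero_numeral)
  have at1: "u = (1, 0)" if "quad_norm d u = 1" "fst u = 1" for u
    using that d0 by (simp add: quad_norm_def prod_eq_iff)
  have "inj_on f {u. quad_norm d u = 1}"
  proof (rule inj_onI, clarify)
    fix x y x' y' assume N: "quad_norm d (x, y) = 1" "quad_norm d (x', y') = 1" and eq: "f (x, y) = f (x', y')"
    show "x = x' \<and> y = y'"
    proof (cases "x = 1")
      case True
      then have "x' = 1" using eq by (auto simp: f_def split: if_splits)
      then show ?thesis using True at1[OF N(1)] at1[OF N(2)] by simp
    next
      case False
      then have x': "x' \<noteq> 1" and slope: "y / (x - 1) = y' / (x' - 1)" using eq by (auto simp: f_def split: if_splits)
      define m where "m = y / (x - 1)"
      have "m = y' / (x' - 1)" unfolding m_def by (rule slope)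
      then have y': "y' = m * (x' - 1)" using x' by simp
      have y: "y = m * (x - 1)" using False by (simp add: m_def)
      \<comment> \<open>Dividing the conic equation on the line by z - 1 leaves a linear equation
        for the second intersection point.\<close>
      have *: "z + 1 = d * m ^ 2 * (z - 1)" if "quad_norm d (z, m * (z - 1)) = 1" "z \<noteq> 1" for z
      proof -
        have "(z - 1) * (z + 1 - d * m ^ 2 * (z - 1)) = quad_norm d (z, m * (z - 1)) - 1"
          by (simp add: quad_norm_def power2_eq_square algebra_simps)
        then show ?thesis using that by simp
      qed
      have e: "x + 1 = d * m ^ 2 * (x - 1)" "x' + 1 = d * m ^ 2 * (x' - 1)"
        using *[of x] *[of x'] N False x' by (simp_all only: y y' simp_thms)
      have "(d * m ^ 2 - 1) * (x - x') = d * m ^ 2 * (x - 1) - d * m ^ 2 * (x' - 1) - (x - x')"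
        by (simp add: algebra_simps)
      also have "\<dots> = 0" by (simp flip: e)
      finally have "(d * m ^ 2 - 1) * (x - x') = 0" .
      \<comment> \<open>The linear equation degenerates only if d = (1/m)^2.\<close>
      moreover have "d * m ^ 2 \<noteq> 1"
      proof
        assume dm: "d * m ^ 2 = 1"
        then have "m \<noteq> 0" by auto
        with dm have "(1 / m) ^ 2 = d" by (simp add: power_divide divide_eq_eq)
        then show False using nonsq by blast
      qed
      ultimately show ?thesis using y y' by simp
    qed
  qed
  then have "card {u. quad_norm d u = 1} \<le> card (UNIV :: 'p mod_ring option set)"
    by (intro card_inj_on_le) auto
  then show ?thesis by (simp add: card_UNIV_option)
qed

text \<open>The \<open>(p - 1)\<close>-st power of a generator of \<open>F[\<surd>d]\<close> has norm one and order \<open>p + 1\<close>.\<close>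
lemma norm_one_cyclic:
  "\<exists>G :: nat \<Rightarrow> 'p mod_ring ^ 2 ^ 2. (\<forall>i j. G (i + j) = G i ** G j) \<and> G 0 = mat 1 \<and>
     G (Suc (CARD('p))) = mat 1 \<and> inj_on G {..CARD('p)} \<and> norm_one E = G ` {..CARD('p)}"
proof -
  let ?K = "quad_ext d" and ?q = "CARD('p)"
  interpret K: Ring.field ?K by (rule field_quad_ext[OF nonsq])
  have p: "?q > 1" using prime_card[where 'a='p] prime_gt_1_nat by blast
  have car [simp]: "carrier ?K = UNIV" by (simp add: quad_ext_def)
  have "finite (carrier ?K)" by simp
  from K.finite_field_mult_group_has_gen[OF this] obtain a where
    a: "a \<in> carrier (Multiplicative_Group.mult_of ?K)"
    "carrier (Multiplicative_Group.mult_of ?K) = {a [^]\<^bsub>?K\<^esub> i | i::nat. i \<in> UNIV}"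
    by (elim bexE)
  have zero: "\<zero>\<^bsub>?K\<^esub> = (0, 0)" and one: "\<one>\<^bsub>?K\<^esub> = (1, 0)" by (simp_all add: quad_ext_def)
  have a0: "a \<noteq> (0, 0)" using a(1) by (simp add: Multiplicative_Group.carrier_mult_of zero)
  have gen: "\<exists>i::nat. u = a [^]\<^bsub>?K\<^esub> i" if "u \<noteq> (0, 0)" for u
    using a(2) that by (auto simp: Multiplicative_Group.carrier_mult_of zero)
  define P where "P i = a [^]\<^bsub>?K\<^esub> i" for i :: nat
  have P_add: "P (i + j) = P i \<otimes>\<^bsub>?K\<^esub> P j" for i j
    unfolding P_def by (rule K.nat_pow_mult[symmetric]) simp
  have P0: "P 0 = (1, 0)" by (simp add: P_def one)
  have normP: "quad_norm d (P i) = quad_norm d a ^ i" for i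
    by (induction i) (simp_all add: P_def one quad_norm_mult, simp_all add: quad_norm_def)
  have na: "quad_norm d a \<noteq> 0" using a0 quad_norm_eq_0_iff[OF nonsq] by blast
  have fermat: "x ^ (?q - 1) = 1" if "x \<noteq> 0" for x :: "'p mod_ring"
  proof -
    have "x * x ^ (?q - 1) = x * 1" using mod_ring_power_card[of x] p by (simp flip: power_Suc)
    then show ?thesis using that by simp
  qed
  \<comment> \<open>p^2 - 1, the order of the multiplicative group of the extension.\<close>
  let ?n = "(?q - 1) * Suc ?q"
  have n0: "?n > 0" using p by simp
  have "card (- {(0, 0) :: 'p mod_ring \<times> 'p mod_ring}) = ?q * ?q - 1"
    by (simp add: Compl_eq_Diff_UNIV card_Diff_subset)
  also have "\<dots> = ?n" using p by (cases ?q) (simp_all add: algebra_simps)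
  finally have card: "card (- {(0, 0) :: 'p mod_ring \<times> 'p mod_ring}) = ?n" .
  have nz: "P i \<noteq> (0, 0)" for i
    using normP[of i] na quad_norm_eq_0_iff[OF nonsq, of "P i"] by simp
  \<comment> \<open>By pigeonhole the powers repeat with a period \<open>m\<close> of at most
    \<open>?n\<close>; since they exhaust the group, \<open>m\<close> is exactly
    \<open>?n\<close>.\<close>
  have "\<not> inj_on P {..?n}"
  proof
    assume "inj_on P {..?n}"
    then have "card {..?n} \<le> card (- {(0, 0) :: 'p mod_ring \<times> 'p mod_ring})"
      using nz nz[symmetric] by (intro card_inj_on_le) auto
    then show False by (simp only: card card_atMost Suc_n_not_le_n)
  qed
  then obtain i j where ij: "i < j" "j \<le> ?n" "P i = P j"
    unfolding inj_on_def by (metis atMost_iff linorder_neqE_nat)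
  define m where "m = j - i"
  have m: "0 < m" "m \<le> ?n" using ij by (auto simp: m_def)
  have "P (i + m) = P (i + 0)" using ij by (simp add: m_def)
  then have "P i \<otimes>\<^bsub>?K\<^esub> P m = P i \<otimes>\<^bsub>?K\<^esub> P 0" by (simp only: P_add)
  then have Pm: "P m = P 0" using K.m_lcancel[of "P i" "P m" "P 0"] nz[of i] zero by simp
  have Pmod: "P k = P (k mod m)" for k
  proof -
    have "P (l * m) = P 0" for l
      by (induction l) (simp_all add: P_add Pm, simp add: P0 quad_ext_def)
    then have "P (k div m * m + k mod m) = P 0 \<otimes>\<^bsub>?K\<^esub> P (k mod m)" by (simp only: P_add)
    then show ?thesis by (simp add: P_def)
  qed
  have img: "P ` {..<m} = - {(0, 0)}"
  proof
    show "- {(0, 0)} \<subseteq> P ` {..<m}"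
    proof
      fix u :: "'p mod_ring \<times> 'p mod_ring" assume "u \<in> - {(0, 0)}"
      then obtain i where "u = P i" using gen unfolding P_def by blast
      then have "u = P (i mod m)" using Pmod by metis
      then show "u \<in> P ` {..<m}" using m by auto
    qed
  qed (use nz nz[symmetric] in auto)
  then have "?n \<le> m" using card card_image_le[of "{..<m}" P] by simp
  then have mn: "m = ?n" using m by simp
  have injP: "inj_on P {..<?n}"
    using img card unfolding mn by (intro eq_card_imp_inj_on) simp_all
  \<comment> \<open>\<open>G j\<close> represents the j-th power of a^(p-1).\<close>
  define G where "G j = plane E (fst (P ((?q - 1) * j))) (snd (P ((?q - 1) * j)))" for j
  have "G (i + j) = G i ** G j" for i j
    unfolding G_def plane_mult by (simp add: distrib_left P_add)
  moreover have G0: "G 0 = mat 1"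
    by (simp add: G_def P0 matrix_eq_iff_2 mat_def)
  moreover have "G (Suc ?q) = mat 1"
    using G0 Pm unfolding mn by (simp add: G_def)
  moreover have inj: "inj_on G {..?q}"
  proof (rule inj_onI)
    fix i j assume ij: "i \<in> {..?q}" "j \<in> {..?q}" "G i = G j"
    then have "P ((?q - 1) * i) = P ((?q - 1) * j)" by (simp add: G_def plane_inj)
    moreover have "(?q - 1) * i < ?n" "(?q - 1) * j < ?n"
      using ij(1,2) p by (simp_all only: mult_less_cancel1 atMost_iff less_Suc_eq_le) simp_all
    ultimately have "(?q - 1) * i = (?q - 1) * j" using injP by (auto dest: inj_onD)
    then show "i = j" using p by simp
  qed
  moreover have "norm_one E = G ` {..?q}"
  proof -
    have eq: "norm_one E = (\<lambda>u. plane E (fst u) (snd u)) ` {u. quad_norm d u = 1}"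
    proof (intro Set.set_eqI iffI)
      fix M assume "M \<in> norm_one E"
      then obtain x y where xy: "M = plane E x y" "det M = 1" unfolding norm_one_def SL2_def by blast
      then have "quad_norm d (x, y) = 1" using det_plane[of "(x, y)"] by simp
      then show "M \<in> (\<lambda>u. plane E (fst u) (snd u)) ` {u. quad_norm d u = 1}"
        using xy by (intro image_eqI[of _ _ "(x, y)"]) simp_all
    next
      fix M assume "M \<in> (\<lambda>u. plane E (fst u) (snd u)) ` {u. quad_norm d u = 1}"
      then show "M \<in> norm_one E" using det_plane unfolding norm_one_def SL2_def by auto
    qed
    \<comment> \<open>The conic bounds the order by p + 1, and the powers \<open>G\<close> already
      supply that many elements, of norm one by Fermat.\<close>
    then have "card (norm_one E) \<le> Suc ?q" "finite (norm_one E)"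
      using card_norm_one_le card_image_le[of "{u. quad_norm d u = 1}" "\<lambda>u. plane E (fst u) (snd u)"] by simp_all
    moreover have "G ` {..?q} \<subseteq> norm_one E"
      unfolding eq G_def using normP fermat[OF na] by (auto simp: power_mult)
    moreover have "card (G ` {..?q}) = Suc ?q" using inj by (simp add: card_image)
    ultimately show ?thesis by (metis card_seteq)
  qed
  ultimately show ?thesis by blast
qed

end

section \<open>Multiplicity one\<close>

lemma maximal_torus_subgroup:
  fixes T :: "('p::prime_card mod_ring ^ 2 ^ 2) set"
  assumes "maximal_torus T"
  shows "SL2_subgroup T"
proof -
  obtain S where S: "maximal_algebraic_torus S" "T = {M. map_matrix to_ac M \<in> S}"
    using assms unfolding maximal_torus_def by blast
  have sub: "SL2_subgroup S" using S(1) unfolding maximal_algebraic_torus_def algebraic_torus_def by blast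
  have one: "mat 1 \<in> T" using sub S(2) by (simp add: SL2_subgroup_def map_matrix_to_ac_mat)
  have SL: "g \<in> SL2" if "g \<in> T" for g
  proof -
    have "map_matrix to_ac g \<in> SL2" using sub that S(2) unfolding SL2_subgroup_def by blast
    then have "to_ac (det g) = to_ac 1" by (simp add: SL2_def det_map_matrix_to_ac)
    then show ?thesis unfolding to_ac_eq_iff by (simp add: SL2_def)
  qed
  have mult: "g ** h \<in> T" if "g \<in> T" "h \<in> T" for g h
    using sub that S(2) by (simp add: SL2_subgroup_def map_matrix_to_ac_mult)
  have inv: "matrix_inv g \<in> T" if "g \<in> T" for g
    using sub that S(2) map_matrix_to_ac_inverse(1)[OF SL2_invertible[OF SL[OF that]]]
    unfolding SL2_subgroup_def by (metis mem_Collect_eq)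
  show ?thesis unfolding SL2_subgroup_def using one SL mult inv by blast
qed

context weil
begin

text \<open>A torus of order \<open>p + 1\<close> has \<open>p\<close> characters other than the quadratic one. If each of them
  occurs, the generator has \<open>p = dim H\<close> distinct eigenvalues, which are therefore simple.\<close>
lemma multiplicity_one_cyclic:
  fixes G :: "nat \<Rightarrow> 'p mod_ring ^ 2 ^ 2"
  assumes odd: "odd CARD('p)" and T: "SL2_subgroup T"
    and occurs: "\<And>\<theta>. \<theta> \<in> nonquadratic_dual T \<Longrightarrow> \<exists>\<phi>\<in>eigenspace \<rho> T \<theta>. \<phi> \<noteq> 0"
    and G_add: "\<And>i j. G (i + j) = G i ** G j" and G0: "G 0 = mat 1" and Gq: "G (Suc (CARD('p))) = mat 1"
    and inj: "inj_on G {..CARD('p)}" and img: "T = G ` {..CARD('p)}"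
  shows "multiplicity_one T"
proof -
  let ?q = "Suc (CARD('p))"
  have p: "CARD('p) > 1" using prime_card[where 'a='p] prime_gt_1_nat by blast
  have Gmod: "G k = G (k mod ?q)" for k
  proof -
    have "G (l * ?q) = mat 1" for l by (induction l) (simp_all only: mult_Suc mult_0 G_add G0 Gq matrix_mul_lid)
    then have "G (k div ?q * ?q + k mod ?q) = G (k mod ?q)" by (simp only: G_add matrix_mul_lid)
    then show ?thesis by (simp only: div_mult_mod_eq)
  qed
  have inT: "G k \<in> T" for k
    using Gmod[of k] unfolding img by (metis atMost_iff image_eqI less_Suc_eq_le mod_less_divisor zero_less_Suc)
  have \<theta>_pow: "\<theta> (G k) = \<theta> (G 1) ^ k" and \<theta>_root: "\<theta> (G 1) ^ ?q = 1" and \<theta>_ne: "\<theta> (G 1) \<noteq> - 1"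
    if \<theta>: "\<theta> \<in> nonquadratic_dual T" for \<theta> k
  proof -
    have \<theta>_mult: "\<theta> (G (i + j)) = \<theta> (G i) * \<theta> (G j)" for i j
      using \<theta> inT by (simp add: nonquadratic_dual_def torus_dual_def G_add)
    have "\<theta> (G 0) \<noteq> 0" using \<theta> inT[of 0] by (auto simp: nonquadratic_dual_def torus_dual_def)
    then have \<theta>0: "\<theta> (G 0) = 1" using \<theta>_mult[of 0 0] by simp
    show pow: "\<theta> (G k) = \<theta> (G 1) ^ k" for k
    proof (induction k)
      case (Suc k)
      have "\<theta> (G (Suc k)) = \<theta> (G 1) * \<theta> (G k)" using \<theta>_mult[of 1 k] by (simp only: plus_1_eq_Suc)
      then show ?case by (simp only: Suc.IH power_Suc)
    qed (simp add: \<theta>0)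
    show "\<theta> (G 1) ^ ?q = 1" using pow[of ?q] \<theta>0 G0 Gq by simp
    show "\<theta> (G 1) \<noteq> - 1"
    proof
      assume m1: "\<theta> (G 1) = - 1"
      have sq: "\<theta> (G k) ^ 2 = 1" for k
        unfolding pow[of k] m1 by (simp add: power2_eq_square)
      have "has_order_two T \<theta>"
        unfolding has_order_two_def
      proof
        show "\<exists>g\<in>T. \<theta> g \<noteq> 1" using inT[of 1] m1 by force
        show "\<forall>g\<in>T. \<theta> g ^ 2 = 1" unfolding img using sq by blast
      qed
      then show False using \<theta> by (simp add: nonquadratic_dual_def)
    qed
  qed
  \<comment> \<open>The possible values at the generator: -1 belongs to the quadratic character and
    is a root of unity here because p + 1 is even.\<close>
  define Z where "Z = {z :: complex. z ^ ?q = 1} - {- 1}"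
  have "(- 1 :: complex) ^ ?q = 1" using odd by simp
  then have "card Z = CARD('p)"
    unfolding Z_def using card_complex_roots_unity[of ?q] by (subst card_Diff_singleton) auto
  moreover have "\<exists>\<phi>. \<phi> \<noteq> 0 \<and> \<rho> (G 1) \<phi> = z *s \<phi>" if z: "z \<in> Z" for z
  proof -
    \<comment> \<open>The character sending the generator to \<open>z\<close>, defined by the
      discrete logarithm to base \<open>G 1\<close>.\<close>
    define \<theta> where "\<theta> = restrict (\<lambda>M. z ^ (the_inv_into {..CARD('p)} G M)) T"
    have zmod: "z ^ k = z ^ (k mod ?q)" for k
    proof -
      have "z ^ (?q * (k div ?q) + k mod ?q) = z ^ (k mod ?q)"
        using z unfolding power_add power_mult by (simp add: Z_def del: power_Suc)
      then show ?thesis by (simp only: mult_div_mod_eq)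
    qed
    have \<theta>G: "\<theta> (G k) = z ^ k" for k
    proof -
      have "k mod ?q \<in> {..CARD('p)}" by (metis atMost_iff less_Suc_eq_le mod_less_divisor zero_less_Suc)
      then have "the_inv_into {..CARD('p)} G (G k) = k mod ?q"
        using Gmod[of k] the_inv_into_f_f[OF inj] by metis
      then show ?thesis using inT[of k] zmod[of k] by (simp add: \<theta>_def)
    qed
    have z0: "z \<noteq> 0" using z by (auto simp: Z_def)
    have "\<theta> \<in> torus_dual T"
      unfolding torus_dual_def
    proof (intro CollectI conjI ballI)
      show "\<theta> \<in> T \<rightarrow>\<^sub>E - {0}" using z0 by (auto simp: \<theta>_def)
      fix g h assume "g \<in> T" "h \<in> T"
      then obtain i j where "g = G i" "h = G j" unfolding img by blast
      then show "\<theta> (g ** h) = \<theta> g * \<theta> h" by (simp add: \<theta>G power_add flip: G_add)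
    qed
    moreover have "\<not> has_order_two T \<theta>"
    proof
      assume two: "has_order_two T \<theta>"
      then have "z ^ 2 = 1" using inT[of 1] \<theta>G[of 1] unfolding has_order_two_def by (metis power_one_right)
      \<comment> \<open>Only -1 could give order two, and \<open>Z\<close> excludes it; z = 1 makes
        \<theta> trivial.\<close>
      then have "z = 1" using z by (auto simp: Z_def power2_eq_1_iff)
      then have "\<theta> g = 1" if "g \<in> T" for g using that \<theta>G unfolding img by auto
      then show False using two unfolding has_order_two_def by blast
    qed
    ultimately have "\<theta> \<in> nonquadratic_dual T" by (simp add: nonquadratic_dual_def)
    then obtain \<phi> where "\<phi> \<in> eigenspace \<rho> T \<theta>" "\<phi> \<noteq> 0" using occurs by blast
    then show ?thesis using inT[of 1] \<theta>G[of 1] by (auto simp: eigenspace_def)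
  qed
  then obtain v where v: "\<And>z. z \<in> Z \<Longrightarrow> v z \<noteq> 0 \<and> \<rho> (G 1) (v z) = z *s v z" by metis
  moreover have "G 1 \<in> SL2" using T inT[of 1] unfolding SL2_subgroup_def by blast
  ultimately have simple: "\<exists>k. \<phi>' = k *s \<phi>"
    if "l \<in> Z" "\<rho> (G 1) \<phi> = l *s \<phi>" "\<rho> (G 1) \<phi>' = l *s \<phi>'" "\<phi> \<noteq> 0" for l \<phi> \<phi>'
    using eigenvalue_simple[OF unitary] that by blast
  show ?thesis
    unfolding multiplicity_one_def
  proof (intro ballI impI)
    fix \<theta> \<phi> \<phi>'
    assume \<theta>: "\<theta> \<in> nonquadratic_dual T"
      and \<phi>: "\<phi> \<in> eigenspace \<rho> T \<theta>" "\<phi>' \<in> eigenspace \<rho> T \<theta>" "\<phi> \<noteq> 0"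
    have "\<theta> (G 1) \<in> Z" using \<theta>_root[OF \<theta>] \<theta>_ne[OF \<theta>] by (simp add: Z_def)
    then show "\<exists>k. \<phi>' = k *s \<phi>" using simple \<phi> inT[of 1] by (simp add: eigenspace_def)
  qed
qed

text \<open>The torus is split or cyclic of order p + 1 according to whether -det E is a
  square.\<close>

lemma multiplicity_one_maximal_torus:
  assumes odd: "odd CARD('p)" and T: "maximal_torus T"
    and occurs: "\<And>\<theta>. \<theta> \<in> nonquadratic_dual T \<Longrightarrow> \<exists>\<phi>\<in>eigenspace \<rho> T \<theta>. \<phi> \<noteq> 0"
  shows "multiplicity_one T"
proof -
  obtain E where E: "E $ 2 $ 2 = - E $ 1 $ 1" "det E \<noteq> 0" "T = norm_one E"
    using maximal_torus_eq_norm_one[OF odd T] by blast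
  show ?thesis
  proof (cases "\<exists>s. s ^ 2 = - det E")
    case True
    then obtain s where s: "s ^ 2 = - det E" by blast
    then have "s \<noteq> 0" using E(2) by auto
    then obtain h where h: "h \<in> SL2" "T = conj_set h diag_torus"
      using norm_one_split[OF mod_ring_two_neq_0[OF odd] E(1) s] E(3) by blast
    show ?thesis
      using multiplicity_one_conj[OF h(1) _ multiplicity_one_diag_torus[OF odd]]
        maximal_torus_subgroup[OF T] unfolding h(2) by blast
  next
    case False
    then obtain G where "\<forall>i j. G (i + j) = G i ** G j" "G 0 = mat 1" "G (Suc (CARD('p))) = mat 1"
      "inj_on G {..CARD('p)}" "T = G ` {..CARD('p)}"
      using norm_one_cyclic[of E "- det E"] E(1,3) by auto
    then show ?thesis
      using multiplicity_one_cyclic[OF odd maximal_torus_subgroup[OF T] occurs] by blast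
  qed
qed

end

theorem mainTheorem4:
  fixes \<rho> :: "'p::prime_card mod_ring ^ 2 ^ 2 \<Rightarrow> 'p hilb \<Rightarrow> 'p hilb"
    and ev :: "'p eigvecs"
  assumes "odd CARD('p)"
    and "weil_representation \<rho>"
    and "unit_eigenvectors \<rho> ev"
  shows "(\<forall>g\<in>SL2. \<forall>T. maximal_torus T \<longrightarrow>
            maximal_torus (conj_set g T) \<and>
            (\<forall>\<phi>\<in>torus_basis ev T. in_up_to_phase (\<rho> g \<phi>) (torus_basis ev (conj_set g T)))) \<and>
         (\<forall>\<phi>\<in>oscillator_system ev. in_up_to_phase (dft \<phi>) (oscillator_system ev))"
proof -
  interpret weil \<rho> by (rule weil.intro) (rule assms(2))
  have ev: "ev T \<theta> \<in> eigenspace \<rho> T \<theta>" "cinner (ev T \<theta>) (ev T \<theta>) = 1"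
    if "maximal_torus T" "\<theta> \<in> nonquadratic_dual T" for T \<theta>
    using assms(3) that unfolding unit_eigenvectors_def by blast+
  have ev_nz: "ev T \<theta> \<noteq> 0" if "maximal_torus T" "\<theta> \<in> nonquadratic_dual T" for T \<theta>
    using ev(2)[OF that] cinner_self_eq_0_iff[of "ev T \<theta>"] by auto
  have one: "multiplicity_one T" if "maximal_torus T" for T
    \<comment> \<open>The chosen unit vectors show that every nonquadratic character occurs.\<close>
    using multiplicity_one_maximal_torus[OF assms(1) that] ev(1)[OF that] ev_nz[OF that] by blast
  have main: "in_up_to_phase (\<rho> g \<phi>) (torus_basis ev (conj_set g T))"
    if g: "g \<in> SL2" and T: "maximal_torus T" and \<phi>: "\<phi> \<in> torus_basis ev T" for g T \<phi>
  proof -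
    obtain \<theta> where \<theta>: "\<theta> \<in> nonquadratic_dual T" "\<phi> = ev T \<theta>" using \<phi> unfolding torus_basis_def by blast
    let ?T = "conj_set g T"
    let ?\<theta> = "restrict (\<lambda>N. \<theta> (matrix_inv g ** N ** g)) ?T"
    have T': "maximal_torus ?T" by (rule maximal_torus_conj[OF SL2_invertible[OF g] T])
    have \<theta>': "?\<theta> \<in> nonquadratic_dual ?T"
      by (rule nonquadratic_dual_conj[OF SL2_invertible[OF g] maximal_torus_subgroup[OF T] \<theta>(1)])
    have eig: "\<rho> g \<phi> \<in> eigenspace \<rho> ?T ?\<theta>"
      unfolding \<theta>(2) by (rule eigenspace_conj[OF g maximal_torus_subgroup[OF T] ev(1)[OF T \<theta>(1)]])
    have norm: "cinner (\<rho> g \<phi>) (\<rho> g \<phi>) = 1" unfolding cinner_rho[OF g] \<theta>(2) by (rule ev(2)[OF T \<theta>(1)])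
    then have "\<rho> g \<phi> \<noteq> 0" using cinner_self_eq_0_iff[of "\<rho> g \<phi>"] by auto
    \<comment> \<open>Both vectors lie in the same eigenline; having unit norm, they differ by a
      phase.\<close>
    then obtain k where k: "ev ?T ?\<theta> = k *s \<rho> g \<phi>"
      using one[OF T'] \<theta>' eig ev(1)[OF T' \<theta>'] unfolding multiplicity_one_def by blast
    have "k * cnj k = 1"
      using ev(2)[OF T' \<theta>'] norm unfolding k by (simp add: cinner_scale_left cinner_scale_right mult.commute)
    then have "of_real ((cmod k)\<^sup>2) = (1 :: complex)" by (simp only: complex_norm_square)
    then have "(cmod k)\<^sup>2 = 1" by (simp only: of_real_eq_1_iff)
    then have "cmod k = 1" using norm_ge_zero[of k] by (simp only: power2_eq_1_iff) linarith
    moreover have "k *s \<rho> g \<phi> \<in> torus_basis ev ?T"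
      unfolding k[symmetric] torus_basis_def using \<theta>' by blast
    ultimately show ?thesis unfolding in_up_to_phase_def by blast
  qed
  have fourier: "in_up_to_phase (dft \<phi>) (oscillator_system ev)" if \<phi>: "\<phi> \<in> oscillator_system ev" for \<phi>
  proof -
    obtain T where T: "maximal_torus T" "\<phi> \<in> torus_basis ev T"
      using \<phi> unfolding oscillator_system_def by blast
    obtain c where c: "cmod c = 1" "\<And>\<phi>. \<rho> fourier_matrix \<phi> = c *s dft \<phi>" using rho_fourier by blast
    obtain k where k: "cmod k = 1" "k *s \<rho> fourier_matrix \<phi> \<in> torus_basis ev (conj_set fourier_matrix T)"
      using main[OF fourier_matrix_SL2 T] unfolding in_up_to_phase_def by blast
    \<comment> \<open>The phase relating \<open>dft\<close> to \<rho> combines with the phase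
      relating the image to the chosen vector.\<close>
    have "(k * c) *s dft \<phi> \<in> oscillator_system ev"
      using k(2) maximal_torus_conj[OF SL2_invertible[OF fourier_matrix_SL2] T(1)]
      unfolding oscillator_system_def c(2) by (auto simp: vector_smult_assoc)
    moreover have "cmod (k * c) = 1" using k(1) c(1) by (simp add: norm_mult)
    ultimately show ?thesis unfolding in_up_to_phase_def by blast
  qed
  show ?thesis
    using main fourier maximal_torus_conj SL2_invertible by blast
qed

end
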